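(* Let $\Pi$ be a polar space of rank $n$ and let $m\le n$. Then the image of every isometric embedding of the hypercube graph $H_{m}$ in the Grassmann graph $\Gamma_{n-1}(\Pi)$ is an apartment in a parabolic subspace $[M\rangle_{n-1}$, where $M$ is an $(n-m-1)$-dimensional singular subspace of $\Pi$. In particular, the image of every isometric embedding of $H_{n}$ in $\Gamma_{n-1}(\Pi)$ is an apartment of ${\mathcal G}_{n-1}(\Pi)$.
   Context: A partial linear space is a pair $(P,\mathcal L)$ of a set of points and a family of proper subsets (lines), each with at least two points, every point on a line, and two distinct collinear points lying on exactly one line. A subspace is a set of points containing the line through any two of its distinct collinear points; it is singular if any two of its points are collinear; dimension of a subspace is the least $\alpha$ such that it is spanned by an independent set of size $\alpha+1$ (the empty set has dimension $-1$, points dimension $0$). A polar space is a partial linear space $\Pi=(P,\mathcal L)$ in which every line has at least three points, no point is collinear with all points, each point is collinear with exactly one or all points of any line, and every flag of singular subspaces is finite. Write $p\perp q$ for collinearity. If some maximal singular subspace contains more than one line, all maximal singular subspaces are projective spaces of the same dimension $n-1\ge 2$, and $n$ is the rank of $\Pi$. ${\mathcal G}_{k}(\Pi)$ denotes the set of $k$-dimensional singular subspaces. $\Gamma_{n-1}(\Pi)$ is the graph with vertex set ${\mathcal G}_{n-1}(\Pi)$ in which two maximal singular subspaces are adjacent iff their intersection is $(n-2)$-dimensional. For a singular subspace $M$ and $k>\dim M$, $[M\rangle_{k}$ is the set of elements of ${\mathcal G}_{k}(\Pi)$ containing $M$; $[M\rangle_{n-1}$ is called a parabolic subspace. A frame of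 a rank $n$ polar space is a set of $2n$ points $\{p_1,\dots,p_{2n}\}$ such that for each $i$ there is a unique $\sigma(i)$ with $p_i\not\perp p_{\sigma(i)}$. The apartment of ${\mathcal G}_{n-1}(\Pi)$ associated with a frame $B$ is the set of all maximal singular subspaces spanned by subsets of $B$ (i.e. $\langle p_{i_1},\dots,p_{i_n}\rangle$ with $\{i_1,\dots,i_n\}\cap\{\sigma(i_1),\dots,\sigma(i_n)\}=\emptyset$). If $M$ is a singular subspace and $B$ a frame such that $M$ is spanned by a subset of $B$, the intersection of the apartment associated with $B$ with $[M\rangle_{n-1}$ is called an apartment of $[M\rangle_{n-1}$ (for $M=\emptyset$ these are the apartments of ${\mathcal G}_{n-1}(\Pi)$). The hypercube graph $H_m$ has as vertices the maximal subsets $X\subset\{1,\dots,m,-1,\dots,-m\}$ containing no pair $i,-i$, two being adjacent iff they share $m-1$ elements. An isometric embedding of a graph in another is an injection on vertices preserving graph distance. *)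

theory Defs
  imports Main "HOL-Library.Extended_Nat"
begin

locale partial_linear_space =
  fixes P :: "'a set" and L :: "'a set set"
  assumes line_proper: "l \<in> L \<Longrightarrow> l \<subset> P"
    and line_two_points: "l \<in> L \<Longrightarrow> \<exists>p\<in>l. \<exists>q\<in>l. p \<noteq> q"
    and point_on_line: "p \<in> P \<Longrightarrow> \<exists>l\<in>L. p \<in> l"
    and line_unique: "\<lbrakk>p \<noteq> q; \<exists>l\<in>L. p \<in> l \<and> q \<in> l\<rbrakk> \<Longrightarrow> \<exists>!l. l \<in> L \<and> p \<in> l \<and> q \<in> l"

text \<open>Since every point lies on a line, every point is collinear with itself.\<close>

definition collinear :: "'a set set \<Rightarrow> 'a \<Rightarrow> 'a \<Rightarrow> bool" where
  "collinear L p q \<longleftrightarrow> (\<exists>l\<in>L. p \<in> l \<and> q \<in> l)"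

definition subspace :: "'a set \<Rightarrow> 'a set set \<Rightarrow> 'a set \<Rightarrow> bool" where
  "subspace P L S \<longleftrightarrow>
     S \<subseteq> P \<and> (\<forall>p\<in>S. \<forall>q\<in>S. \<forall>l\<in>L. p \<noteq> q \<and> p \<in> l \<and> q \<in> l \<longrightarrow> l \<subseteq> S)"

definition singular :: "'a set \<Rightarrow> 'a set set \<Rightarrow> 'a set \<Rightarrow> bool" where
  "singular P L S \<longleftrightarrow> subspace P L S \<and> (\<forall>p\<in>S. \<forall>q\<in>S. collinear L p q)"

definition maximal_singular :: "'a set \<Rightarrow> 'a set set \<Rightarrow> 'a set \<Rightarrow> bool" where
  "maximal_singular P L S \<longleftrightarrow>
     singular P L S \<and> (\<forall>T. singular P L T \<and> S \<subseteq> T \<longrightarrow> T = S)"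

definition pspan :: "'a set \<Rightarrow> 'a set set \<Rightarrow> 'a set \<Rightarrow> 'a set" where
  "pspan P L X = \<Inter>{S. subspace P L S \<and> X \<subseteq> S}"

definition independent :: "'a set \<Rightarrow> 'a set set \<Rightarrow> 'a set \<Rightarrow> bool" where
  "independent P L X \<longleftrightarrow> X \<subseteq> P \<and> (\<forall>Y. Y \<subset> X \<longrightarrow> pspan P L Y \<noteq> pspan P L X)"

text \<open>\<open>has_dim P L S k\<close>: the least size of an independent set spanning \<open>S\<close> is the finite number
  \<open>k + 1\<close>. Infinite spanning sets cannot be smaller, so they play no role in the minimum.
  The dimension is an integer because the empty set has dimension \<open>-1\<close>.\<close>

definition has_dim :: "'a set \<Rightarrow> 'a set set \<Rightarrow> 'a set \<Rightarrow> int \<Rightarrow> bool" where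
  "has_dim P L S k \<longleftrightarrow>
     (\<exists>X. finite X \<and> independent P L X \<and> pspan P L X = S \<and> int (card X) = k + 1) \<and>
     (\<forall>X. finite X \<and> independent P L X \<and> pspan P L X = S \<longrightarrow> k + 1 \<le> int (card X))"

text \<open>In the last axiom, a flag of singular subspaces is a set of singular subspaces that is
  linearly ordered by inclusion.\<close>

locale polar_space = partial_linear_space P L
  for P :: "'a set" and L :: "'a set set" +
  assumes line_three_points:
      "l \<in> L \<Longrightarrow> \<exists>p\<in>l. \<exists>q\<in>l. \<exists>r\<in>l. p \<noteq> q \<and> p \<noteq> r \<and> q \<noteq> r"
    and nondegenerate: "\<not> (\<exists>p\<in>P. \<forall>q\<in>P. collinear L p q)"
    and one_or_all: "\<lbrakk>p \<in> P; l \<in> L\<rbrakk> \<Longrightarrow>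
      (\<exists>!q. q \<in> l \<and> collinear L p q) \<or> (\<forall>q\<in>l. collinear L p q)"
    and finite_flags: "subset.chain {S. singular P L S} F \<Longrightarrow> finite F"

definition has_rank :: "'a set \<Rightarrow> 'a set set \<Rightarrow> nat \<Rightarrow> bool" where
  "has_rank P L n \<longleftrightarrow>
     (\<exists>S. maximal_singular P L S \<and> (\<exists>l\<in>L. \<exists>l'\<in>L. l \<noteq> l' \<and> l \<subseteq> S \<and> l' \<subseteq> S)) \<and>
     (\<forall>S. maximal_singular P L S \<longrightarrow> has_dim P L S (int n - 1))"

definition polar_grassmannian :: "'a set \<Rightarrow> 'a set set \<Rightarrow> int \<Rightarrow> 'a set set" where
  "polar_grassmannian P L k = {S. singular P L S \<and> has_dim P L S k}"

definition dual_polar_edges :: "'a set \<Rightarrow> 'a set set \<Rightarrow> nat \<Rightarrow> ('a set \<times> 'a set) set" where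
  "dual_polar_edges P L n =
     {(S, T). S \<in> polar_grassmannian P L (int n - 1) \<and> T \<in> polar_grassmannian P L (int n - 1) \<and>
              has_dim P L (S \<inter> T) (int n - 2)}"

text \<open>The elements of the Grassmannian above \<open>M\<close>; for \<open>k = dim M\<close> this degenerates to \<open>{M}\<close>.\<close>

definition containing :: "'a set \<Rightarrow> 'a set set \<Rightarrow> 'a set \<Rightarrow> int \<Rightarrow> 'a set set" where
  "containing P L M k = {S \<in> polar_grassmannian P L k. M \<subseteq> S}"

definition frame :: "'a set \<Rightarrow> 'a set set \<Rightarrow> nat \<Rightarrow> 'a set \<Rightarrow> bool" where
  "frame P L n B \<longleftrightarrow>
     B \<subseteq> P \<and> finite B \<and> card B = 2 * n \<and> (\<forall>p\<in>B. \<exists>!q. q \<in> B \<and> \<not> collinear L p q)"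

definition apartment :: "'a set \<Rightarrow> 'a set set \<Rightarrow> 'a set \<Rightarrow> 'a set set" where
  "apartment P L B = {S. maximal_singular P L S \<and> (\<exists>X\<subseteq>B. S = pspan P L X)}"

definition is_apartment :: "'a set \<Rightarrow> 'a set set \<Rightarrow> nat \<Rightarrow> 'a set set \<Rightarrow> bool" where
  "is_apartment P L n A \<longleftrightarrow> (\<exists>B. frame P L n B \<and> A = apartment P L B)"

definition is_parabolic_apartment ::
    "'a set \<Rightarrow> 'a set set \<Rightarrow> nat \<Rightarrow> 'a set \<Rightarrow> 'a set set \<Rightarrow> bool" where
  "is_parabolic_apartment P L n M A \<longleftrightarrow>
     (\<exists>B. frame P L n B \<and> (\<exists>X\<subseteq>B. M = pspan P L X) \<and>
          A = apartment P L B \<inter> containing P L M (int n - 1))"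

definition no_opposite_pair :: "nat \<Rightarrow> int set \<Rightarrow> bool" where
  "no_opposite_pair m X \<longleftrightarrow> X \<subseteq> {1..int m} \<union> {- int m..-1} \<and> (\<forall>i\<in>X. - i \<notin> X)"

definition hypercube_vertices :: "nat \<Rightarrow> int set set" where
  "hypercube_vertices m =
     {X. no_opposite_pair m X \<and> (\<forall>Y. no_opposite_pair m Y \<and> X \<subseteq> Y \<longrightarrow> Y = X)}"

definition hypercube_edges :: "nat \<Rightarrow> (int set \<times> int set) set" where
  "hypercube_edges m =
     {(X, Y). X \<in> hypercube_vertices m \<and> Y \<in> hypercube_vertices m \<and> card (X \<inter> Y) + 1 = m}"

text \<open>Length of a shortest walk; it is \<open>\<infinity>\<close> if there is no walk.\<close>

definition graph_dist :: "('v \<times> 'v) set \<Rightarrow> 'v \<Rightarrow> 'v \<Rightarrow> enat" where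
  "graph_dist E u v = (INF k\<in>{k. (u, v) \<in> E ^^ k}. enat k)"

definition isometric_embedding ::
    "'v set \<Rightarrow> ('v \<times> 'v) set \<Rightarrow> 'w set \<Rightarrow> ('w \<times> 'w) set \<Rightarrow> ('v \<Rightarrow> 'w) \<Rightarrow> bool" where
  "isometric_embedding V E W F f \<longleftrightarrow>
     inj_on f V \<and> f ` V \<subseteq> W \<and>
     (\<forall>u\<in>V. \<forall>v\<in>V. graph_dist F (f u) (f v) = graph_dist E u v)"

end

theory Submission imports Defs begin

text \<open>If \<open>p\<close> lies outside the span of a finite set \<open>X\<close> of mutually collinear points, then some point is
  collinear with all of \<open>X\<close> but not with \<open>p\<close>; this holds even relative to the perp of
  finitely many hyperbolic pairs. It yields the exchange property, hence a rank function on singular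
  subspaces, and it lets one complete a basis of a singular subspace to a frame.

  Two maximal singular subspaces are at distance \<open>d\<close> iff their intersection has corank \<open>d\<close>. For an
  isometric embedding \<open>f\<close> of the hypercube, counting ranks along geodesics gives
  \<open>f X \<inter> f Y \<subseteq> f Z\<close> whenever \<open>X \<inter> Y \<subseteq> Z\<close>. Hence all antipodal pairs have the same intersection
  \<open>M\<close>, and the \<open>f Z\<close> with \<open>i \<in> Z\<close> share a point \<open>p i\<close> outside \<open>M\<close>. These points form the
  part of the frame outside \<open>M\<close>; a basis of \<open>M\<close> and opposite points, chosen in the
  perp of all \<open>p i\<close>, complete it.\<close>

section \<open>Subspaces and cliques\<close>

context partial_linear_space
begin

abbreviation col :: "'a \<Rightarrow> 'a \<Rightarrow> bool" (infix "\<bottom>" 50) where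
  "p \<bottom> q \<equiv> collinear L p q"

abbreviation span :: "'a set \<Rightarrow> 'a set" where
  "span \<equiv> pspan P L"

lemma collinear_sym: "p \<bottom> q \<Longrightarrow> q \<bottom> p"
  by (auto simp: collinear_def)

lemma collinear_commute: "p \<bottom> q \<longleftrightarrow> q \<bottom> p"
  by (auto simp: collinear_def)

lemma collinear_refl: "p \<in> P \<Longrightarrow> p \<bottom> p"
  using point_on_line by (auto simp: collinear_def)

lemma line_subset: "l \<in> L \<Longrightarrow> l \<subseteq> P"
  using line_proper by auto

lemma collinear_on_line: "l \<in> L \<Longrightarrow> p \<in> l \<Longrightarrow> q \<in> l \<Longrightarrow> p \<bottom> q"
  by (auto simp: collinear_def)

lemma subspaceD: "subspace P L S \<Longrightarrow> l \<in> L \<Longrightarrow> p \<in> S \<Longrightarrow> q \<in> S \<Longrightarrow> p \<noteq> q \<Longrightarrow>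
    p \<in> l \<Longrightarrow> q \<in> l \<Longrightarrow> r \<in> l \<Longrightarrow> r \<in> S"
  unfolding subspace_def by blast

lemma subspace_subset: "subspace P L S \<Longrightarrow> S \<subseteq> P"
  by (simp add: subspace_def)

lemma subspace_points: "subspace P L P"
  using line_subset by (auto simp: subspace_def)

lemma subspaceI:
  assumes "S \<subseteq> P"
    and "\<And>p q l r. p \<in> S \<Longrightarrow> q \<in> S \<Longrightarrow> l \<in> L \<Longrightarrow> p \<noteq> q \<Longrightarrow> p \<in> l \<Longrightarrow> q \<in> l \<Longrightarrow> r \<in> l \<Longrightarrow> r \<in> S"
  shows "subspace P L S"
  using assms unfolding subspace_def by (meson subsetI)

lemma subspace_Int:
  assumes "subspace P L S" "subspace P L T" shows "subspace P L (S \<inter> T)"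
proof (rule subspaceI)
  show "S \<inter> T \<subseteq> P" using subspace_subset[OF assms(1)] by auto
  show "r \<in> S \<inter> T" if "p \<in> S \<inter> T" "q \<in> S \<inter> T" "l \<in> L" "p \<noteq> q" "p \<in> l" "q \<in> l" "r \<in> l" for p q l r
    using that subspaceD[OF assms(1) that(3), of p q r] subspaceD[OF assms(2) that(3), of p q r] by auto
qed

lemma subspace_empty: "subspace P L {}"
  by (simp add: subspace_def)

lemma subspace_singleton: "p \<in> P \<Longrightarrow> subspace P L {p}"
  by (simp add: subspace_def)

section \<open>Spans and independent sets\<close>

lemma span_superset: "X \<subseteq> span X"
  by (auto simp: pspan_def)

lemma span_inc: "x \<in> X \<Longrightarrow> x \<in> span X"
  using span_superset by auto

lemma span_least: "subspace P L S \<Longrightarrow> X \<subseteq> S \<Longrightarrow> span X \<subseteq> S"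
  by (auto simp: pspan_def)

lemma span_mono: "X \<subseteq> Y \<Longrightarrow> span X \<subseteq> span Y"
  by (auto simp: pspan_def)

lemma subspace_span: assumes "X \<subseteq> P" shows "subspace P L (span X)"
proof -
  have "span X \<subseteq> P" by (rule span_least[OF subspace_points assms])
  then show ?thesis unfolding subspace_def pspan_def by blast
qed

lemma span_subspace: "subspace P L S \<Longrightarrow> span S = S"
  using span_least[of S S] span_superset[of S] by auto

lemma span_subset_span: "X \<subseteq> span Y \<Longrightarrow> Y \<subseteq> P \<Longrightarrow> span X \<subseteq> span Y"
  by (rule span_least[OF subspace_span])

lemma span_empty: "span {} = {}"
  using span_subspace[OF subspace_empty] .

lemma span_singleton: "p \<in> P \<Longrightarrow> span {p} = {p}"
  using span_subspace[OF subspace_singleton] .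

text \<open>By monotonicity of \<open>span\<close> it is enough to test the subsets that omit a
  single point.\<close>

lemma independent_iff:
  assumes "X \<subseteq> P"
  shows "independent P L X \<longleftrightarrow> (\<forall>x\<in>X. x \<notin> span (X - {x}))"
proof
  assume ind: "independent P L X"
  show "\<forall>x\<in>X. x \<notin> span (X - {x})"
  proof (intro ballI notI)
    fix x assume x: "x \<in> X" "x \<in> span (X - {x})"
    then have "X \<subseteq> span (X - {x})" using span_superset[of "X - {x}"] by auto
    then have "span X \<subseteq> span (X - {x})" using assms by (intro span_subset_span) auto
    moreover have "span (X - {x}) \<subseteq> span X" by (rule span_mono) auto
    ultimately show False using ind x(1) unfolding independent_def
      by (metis Diff_subset Diff_iff insertI1 psubsetI subset_antisym)
  qed
next
  assume *: "\<forall>x\<in>X. x \<notin> span (X - {x})"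
  show "independent P L X" unfolding independent_def
  proof (intro conjI assms allI impI notI)
    fix Y assume Y: "Y \<subset> X" "span Y = span X"
    then obtain x where x: "x \<in> X" "x \<notin> Y" by auto
    then have "span Y \<subseteq> span (X - {x})" using Y by (intro span_mono) auto
    then show False using x * Y(2) span_inc by blast
  qed
qed

text \<open>Unlike \<open>singular\<close>, this passes to subsets; it is the condition on
  generating sets whose spans are singular.\<close>

definition clique :: "'a set \<Rightarrow> bool" where
  "clique X \<longleftrightarrow> X \<subseteq> P \<and> (\<forall>x\<in>X. \<forall>y\<in>X. x \<bottom> y)"

lemma singular_clique: "singular P L S \<Longrightarrow> clique S"
  by (simp add: singular_def clique_def subspace_def)

lemma clique_subset: "clique X \<Longrightarrow> Y \<subseteq> X \<Longrightarrow> clique Y"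
  unfolding clique_def by blast

lemma clique_insert: "clique X \<Longrightarrow> p \<in> P \<Longrightarrow> (\<And>x. x \<in> X \<Longrightarrow> p \<bottom> x) \<Longrightarrow> clique (insert p X)"
  unfolding clique_def using collinear_refl collinear_sym by auto

lemma singular_Int: "singular P L S \<Longrightarrow> subspace P L T \<Longrightarrow> singular P L (S \<inter> T)"
  unfolding singular_def using subspace_Int by blast

lemma singular_subspace: "singular P L S \<Longrightarrow> subspace P L S"
  by (simp add: singular_def)

lemma singular_subset: "singular P L S \<Longrightarrow> S \<subseteq> P"
  by (simp add: singular_def subspace_def)

lemma singular_collinear: "singular P L S \<Longrightarrow> p \<in> S \<Longrightarrow> q \<in> S \<Longrightarrow> p \<bottom> q"
  by (simp add: singular_def)

end

section \<open>Perps in polar spaces\<close>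

context polar_space
begin

definition perp :: "'a \<Rightarrow> 'a set" where
  "perp p = {q \<in> P. p \<bottom> q}"

lemma line_meets_perp: "p \<in> P \<Longrightarrow> l \<in> L \<Longrightarrow> \<exists>q\<in>l. p \<bottom> q"
  using one_or_all[of p l] line_two_points[of l] by blast

lemma collinear_line:
  assumes "p \<in> P" "l \<in> L" "a \<in> l" "b \<in> l" "a \<noteq> b" "p \<bottom> a" "p \<bottom> b" "c \<in> l"
  shows "p \<bottom> c"
  using one_or_all[OF assms(1,2)] assms by blast

lemma subspace_perp: "p \<in> P \<Longrightarrow> subspace P L (perp p)"
  unfolding subspace_def perp_def using collinear_line line_subset by blast

lemma collinear_span:
  assumes "q \<in> P" "X \<subseteq> P" "\<And>x. x \<in> X \<Longrightarrow> q \<bottom> x" "y \<in> span X"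
  shows "q \<bottom> y"
proof -
  have "span X \<subseteq> perp q" using assms by (intro span_least subspace_perp) (auto simp: perp_def)
  then show ?thesis using assms(4) by (auto simp: perp_def)
qed

text \<open>The perp of a point is a subspace, so collinearity extends from generators to the span;
  this is applied once in each argument.\<close>

lemma singular_span:
  assumes "clique X" shows "singular P L (span X)"
proof -
  have X: "X \<subseteq> P" using assms by (simp add: clique_def)
  have sub: "span X \<subseteq> P" using subspace_span[OF X] subspace_subset by auto
  have 1: "x \<bottom> y" if "x \<in> X" "y \<in> span X" for x y
    using collinear_span[of x X y] that X assms by (auto simp: clique_def)
  have "y \<bottom> z" if "y \<in> span X" "z \<in> span X" for y z
    using collinear_span[of y X z] that X 1 sub collinear_sym by blast
  then show ?thesis using subspace_span[OF X] by (simp add: singular_def)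
qed

text \<open>No lines are required inside \<open>Q\<close>, and even the empty set qualifies; so the
  notion survives any number of passages to the perp of a hyperbolic pair.\<close>

definition nondegenerate_subspace :: "'a set \<Rightarrow> bool" where
  "nondegenerate_subspace Q \<longleftrightarrow> subspace P L Q \<and> (\<forall>p\<in>Q. \<exists>q\<in>Q. \<not> p \<bottom> q)"

lemma nondegenerate_subspace_points: "nondegenerate_subspace P"
  using nondegenerate by (auto simp: nondegenerate_subspace_def subspace_points)

text \<open>If every point of \<open>Q\<close> collinear with \<open>x\<close> were collinear with
  \<open>p\<close>, it would be collinear with the whole line \<open>l\<close> through
  \<open>x\<close> and \<open>p\<close>. This inclusion of perps spreads to the points of
  \<open>Q\<close> that are not collinear with \<open>x\<close>, and two of these lead to a
  contradiction.\<close>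

lemma perp_separates_points:
  assumes Q: "nondegenerate_subspace Q" and xp: "x \<in> Q" "p \<in> Q" "x \<noteq> p"
  shows "\<exists>q\<in>Q. x \<bottom> q \<and> \<not> p \<bottom> q"
proof (rule ccontr)
  have sub: "subspace P L Q" and nd: "\<And>p. p \<in> Q \<Longrightarrow> \<exists>q\<in>Q. \<not> p \<bottom> q"
    using Q by (auto simp: nondegenerate_subspace_def)
  have QP: "Q \<subseteq> P" using sub by (rule subspace_subset)
  assume "\<not> ?thesis"
  then have H: "p \<bottom> q" if "q \<in> Q" "x \<bottom> q" for q using that by blast
  have "x \<bottom> p" using H[of x] collinear_refl xp QP collinear_sym by blast
  then obtain l where l: "l \<in> L" "x \<in> l" "p \<in> l" by (auto simp: collinear_def)
  have lQ: "u \<in> Q" if "u \<in> l" for u using subspaceD[OF sub l(1)] l xp that by blast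
  have Hl: "u \<bottom> q" if "u \<in> l" "q \<in> Q" "x \<bottom> q" for u q
    using collinear_line[of q l x p u] that l xp H QP collinear_sym by blast
  \<comment> \<open>The line \<open>k\<close> through \<open>z\<close> and \<open>q\<close> meets
    the perp of \<open>x\<close> in a point \<open>w\<close>, and \<open>u\<close> is collinear with
    both \<open>z\<close> and \<open>w\<close>, hence with \<open>q\<close>.\<close>
  have key: "u \<bottom> q" if u: "u \<in> l" and z: "z \<in> Q" "z \<bottom> u" "\<not> z \<bottom> x" and q: "q \<in> Q" "z \<bottom> q" for u z q
  proof (cases "q = z")
    case True then show ?thesis using z collinear_sym by blast
  next
    case False
    obtain k where k: "k \<in> L" "z \<in> k" "q \<in> k" using q by (auto simp: collinear_def)
    obtain w where w: "w \<in> k" "x \<bottom> w" using line_meets_perp[of x k] xp QP k by blast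
    have "w \<in> Q" using subspaceD[OF sub k(1)] k z q False w by blast
    then have "u \<bottom> w" using Hl u w by blast
    moreover have "w \<noteq> z" using w z collinear_sym by blast
    ultimately show ?thesis using collinear_line[of u k w z q] u lQ QP k w z collinear_sym by blast
  qed
  obtain z where z: "z \<in> Q" "\<not> x \<bottom> z" using nd xp by blast
  obtain u where u: "u \<in> l" "z \<bottom> u" using line_meets_perp[of z l] z QP l by blast
  obtain y where y: "y \<in> Q" "\<not> u \<bottom> y" using nd lQ u by blast
  have yx: "\<not> y \<bottom> x" using y Hl u collinear_sym by blast
  obtain v where v: "v \<in> l" "y \<bottom> v" using line_meets_perp[of y l] y QP l by blast
  \<comment> \<open>On the line through \<open>z\<close> and \<open>u\<close>, the point
    \<open>t\<close> collinear with \<open>y\<close> is collinear with \<open>v\<close> by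
    \<open>key\<close>. Being collinear with \<open>u\<close> and \<open>v\<close>, it is collinear
    with \<open>x\<close>, and then so is \<open>z\<close>.\<close>
  obtain k where k: "k \<in> L" "z \<in> k" "u \<in> k" using u by (auto simp: collinear_def)
  obtain t where t: "t \<in> k" "y \<bottom> t" using line_meets_perp[of y k] y QP k by blast
  have ux: "x \<bottom> u" using collinear_on_line l u by blast
  have zu: "z \<noteq> u" using ux z by blast
  have tQ: "t \<in> Q" using subspaceD[OF sub k(1)] k z u lQ zu t by blast
  have tu: "t \<noteq> u" using t y collinear_sym by blast
  have "v \<bottom> t" using key[OF v(1) y(1)] v yx tQ t by blast
  moreover have "v \<noteq> u" using v y collinear_sym by blast
  moreover have "t \<bottom> u" using collinear_on_line k t by blast
  ultimately have "t \<bottom> x" using collinear_line[of t l v u x] tQ QP l u v collinear_sym by blast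
  then have "x \<bottom> z" using collinear_line[of x k t u z] xp QP k t tu ux collinear_sym by blast
  then show False using z by blast
qed

text \<open>\<open>y'\<close> is the point of the line \<open>x y\<close> collinear with \<open>w\<close>: only the fact that \<open>y\<close> and \<open>y'\<close> are
  interchangeable in the presence of \<open>x\<close> is recorded.\<close>

lemma projection:
  assumes "x \<in> P" "w \<in> P" "\<not> x \<bottom> w" "x \<bottom> y" "x \<noteq> y"
  shows "\<exists>y'\<in>P. w \<bottom> y' \<and> x \<bottom> y' \<and> (\<forall>S. subspace P L S \<longrightarrow> x \<in> S \<longrightarrow> (y \<in> S \<longleftrightarrow> y' \<in> S))"
proof -
  obtain l where l: "l \<in> L" "x \<in> l" "y \<in> l" using assms by (auto simp: collinear_def)
  obtain y' where y': "y' \<in> l" "w \<bottom> y'" using line_meets_perp[of w l] assms l by blast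
  have ne: "y' \<noteq> x" using y' assms collinear_sym by blast
  have "y \<in> S \<longleftrightarrow> y' \<in> S" if "subspace P L S" "x \<in> S" for S
    using subspaceD[OF that(1) l(1), of x y y'] subspaceD[OF that(1) l(1), of x y' y]
      that(2) l y' ne assms(5) by blast
  then show ?thesis using y' l line_subset collinear_on_line by blast
qed

text \<open>Suppose \<open>r\<close> is collinear with everything there. Each \<open>t\<close> in
  \<open>Q\<close> collinear with \<open>x\<close> can be projected from \<open>x\<close> into the
  perp of \<open>w\<close>, so \<open>r\<close> is collinear with \<open>t\<close> as well. The perp
  of \<open>x\<close> in \<open>Q\<close> then lies in that of \<open>r\<close>, which separation of
  points excludes.\<close>

lemma nondegenerate_subspace_perp:
  assumes Q: "nondegenerate_subspace Q" and xw: "x \<in> Q" "w \<in> Q" "\<not> x \<bottom> w"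
  shows "nondegenerate_subspace (Q \<inter> perp x \<inter> perp w)"
proof -
  have sub: "subspace P L Q" using Q by (auto simp: nondegenerate_subspace_def)
  have QP: "Q \<subseteq> P" using sub by (rule subspace_subset)
  have "\<exists>q\<in>Q \<inter> perp x \<inter> perp w. \<not> r \<bottom> q" if r: "r \<in> Q \<inter> perp x \<inter> perp w" for r
  proof (rule ccontr)
    assume "\<not> ?thesis"
    then have H: "r \<bottom> q" if "q \<in> Q" "x \<bottom> q" "w \<bottom> q" for q
      using that QP by (auto simp: perp_def)
    have r': "r \<in> Q" "r \<in> P" "x \<bottom> r" "w \<bottom> r" using r by (auto simp: perp_def)
    have "r \<bottom> t" if t: "t \<in> Q" "x \<bottom> t" for t
    proof (cases "t = x")
      case True then show ?thesis using r' collinear_sym by blast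
    next
      case False
      obtain t' where t': "t' \<in> P" "w \<bottom> t'" "x \<bottom> t'"
        "\<And>S. subspace P L S \<Longrightarrow> x \<in> S \<Longrightarrow> t \<in> S \<longleftrightarrow> t' \<in> S"
        using projection[of x w t] xw t False QP by blast
      have "t' \<in> Q" using t'(4)[OF sub] t xw by blast
      then have "r \<bottom> t'" using H t' by blast
      then have "t \<in> perp r" using t'(4)[OF subspace_perp[of r]] r' xw QP t' collinear_sym
        by (auto simp: perp_def)
      then show ?thesis by (simp add: perp_def)
    qed
    moreover have "x \<noteq> r" using xw r' collinear_sym by blast
    ultimately show False using perp_separates_points[OF Q xw(1) r'(1)] by blast
  qed
  moreover have "subspace P L (Q \<inter> perp x \<inter> perp w)"
    using sub subspace_perp xw QP by (intro subspace_Int) auto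
  ultimately show ?thesis by (simp add: nondegenerate_subspace_def)
qed

text \<open>Moves the points of \<open>X\<close> other than \<open>x\<close> into the perp of the
  hyperbolic pair \<open>x\<close>, \<open>w\<close>, in a way that no subspace through
  \<open>x\<close> can detect.\<close>

lemma projection_clique:
  assumes "clique X" "x \<in> X" "w \<in> P" "\<not> x \<bottom> w"
  obtains g where "\<And>y. y \<in> X - {x} \<Longrightarrow> g y \<in> perp x \<inter> perp w"
    and "\<And>y S. y \<in> X - {x} \<Longrightarrow> subspace P L S \<Longrightarrow> x \<in> S \<Longrightarrow> y \<in> S \<longleftrightarrow> g y \<in> S"
proof -
  have "\<forall>y\<in>X - {x}. \<exists>y'. y' \<in> perp x \<inter> perp w \<and> (\<forall>S. subspace P L S \<longrightarrow> x \<in> S \<longrightarrow> (y \<in> S \<longleftrightarrow> y' \<in> S))"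
  proof
    fix y assume "y \<in> X - {x}"
    then have "x \<in> P" "x \<bottom> y" "x \<noteq> y" using assms by (auto simp: clique_def)
    from projection[OF this(1) assms(3,4) this(2,3)]
    show "\<exists>y'. y' \<in> perp x \<inter> perp w \<and> (\<forall>S. subspace P L S \<longrightarrow> x \<in> S \<longrightarrow> (y \<in> S \<longleftrightarrow> y' \<in> S))"
      by (auto simp: perp_def)
  qed
  from bchoice[OF this] show ?thesis using that by blast
qed

text \<open>Projecting from a point \<open>x\<close> of \<open>X\<close> passes to the perp of a hyperbolic pair \<open>x, w\<close> and
  to a smaller set. For this induction the statement has to be relative to \<open>Q\<close>.\<close>

lemma perp_separates_span:
  assumes "finite X" "nondegenerate_subspace Q" "clique X" "X \<subseteq> Q" "p \<in> Q" "p \<notin> span X"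
  shows "\<exists>q\<in>Q. (\<forall>x\<in>X. q \<bottom> x) \<and> \<not> q \<bottom> p"
  using assms
proof (induction X arbitrary: Q p rule: measure_induct_rule[where f = card])
  case (less X)
  note fin = \<open>finite X\<close> and Q = \<open>nondegenerate_subspace Q\<close> and cl = \<open>clique X\<close> and XQ = \<open>X \<subseteq> Q\<close>
  have sub: "subspace P L Q" and nd: "\<And>p. p \<in> Q \<Longrightarrow> \<exists>q\<in>Q. \<not> p \<bottom> q"
    using Q by (auto simp: nondegenerate_subspace_def)
  have QP: "Q \<subseteq> P" using sub by (rule subspace_subset)
  show ?case
  proof (cases "X = {}")
    case True then show ?thesis using nd less.prems collinear_sym by blast
  next
    case False
    then obtain x where x: "x \<in> X" by auto
    have xQ: "x \<in> Q" "x \<in> P" using x XQ QP by auto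
    show ?thesis
    proof (cases "x \<bottom> p")
      \<comment> \<open>Here \<open>x\<close> itself separates, since it is collinear with all of
        \<open>X\<close>.\<close>
      case False
      then show ?thesis using x xQ cl by (auto simp: clique_def)
    next
      case True
      have px: "x \<noteq> p" using less.prems x span_inc by blast
      obtain w where w: "w \<in> Q" "\<not> x \<bottom> w" using nd xQ by blast
      have wP: "w \<in> P" using w QP by auto
      obtain p' where p': "p' \<in> P" "w \<bottom> p'" "x \<bottom> p'"
        "\<And>S. subspace P L S \<Longrightarrow> x \<in> S \<Longrightarrow> p \<in> S \<longleftrightarrow> p' \<in> S"
        using projection[OF xQ(2) wP w(2) True px] by blast
      obtain g where g: "\<And>y. y \<in> X - {x} \<Longrightarrow> g y \<in> perp x \<inter> perp w"
        "\<And>y S. y \<in> X - {x} \<Longrightarrow> subspace P L S \<Longrightarrow> x \<in> S \<Longrightarrow> y \<in> S \<longleftrightarrow> g y \<in> S"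
        using projection_clique[OF cl x wP w(2)] by blast
      define Y where "Y = g ` (X - {x})"
      have XP: "X \<subseteq> P" using XQ QP by auto
      have sX: "subspace P L (span X)" by (rule subspace_span[OF XP])
      have xs: "x \<in> span X" using x span_inc by blast
      have YX: "Y \<subseteq> span X" using g(2)[OF _ sX xs] span_inc unfolding Y_def by blast
      have "card Y \<le> card (X - {x})" unfolding Y_def using fin by (intro card_image_le) auto
      then have c: "card Y < card X" using fin x by (metis card_Diff1_less le_less_trans)
      have "\<exists>q\<in>Q \<inter> perp x \<inter> perp w. (\<forall>y\<in>Y. q \<bottom> y) \<and> \<not> q \<bottom> p'"
      proof (rule less.IH[OF c])
        show "finite Y" using fin by (simp add: Y_def)
        show "nondegenerate_subspace (Q \<inter> perp x \<inter> perp w)"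
          by (rule nondegenerate_subspace_perp[OF Q xQ(1) w])
        show "clique Y" using singular_clique[OF singular_span[OF cl]] YX clique_subset by blast
        show "Y \<subseteq> Q \<inter> perp x \<inter> perp w"
          using g(1) g(2)[OF _ sub xQ(1)] XQ unfolding Y_def by blast
        show "p' \<in> Q \<inter> perp x \<inter> perp w"
          using p' p'(4)[OF sub xQ(1)] less.prems by (auto simp: perp_def)
        have "p' \<notin> span X" using p'(4)[OF sX xs] less.prems by blast
        then show "p' \<notin> span Y" using span_subset_span[OF YX XP] by blast
      qed
      then obtain q where q: "q \<in> Q" "q \<in> P" "q \<bottom> x" "\<And>y. y \<in> Y \<Longrightarrow> q \<bottom> y" "\<not> q \<bottom> p'"
        using collinear_sym by (auto simp: perp_def)
      \<comment> \<open>\<open>perp q\<close> is a subspace through \<open>x\<close>, so it contains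
        a point exactly when it contains the projection of that point.\<close>
      have sq: "subspace P L (perp q)" "x \<in> perp q" using subspace_perp q xQ by (auto simp: perp_def)
      have "y \<in> perp q" if "y \<in> X - {x}" for y
        using g(2)[OF that sq] g(1)[OF that] q(4)[of "g y"] that unfolding Y_def perp_def by blast
      then have "\<forall>y\<in>X. q \<bottom> y" using q by (auto simp: perp_def)
      moreover have "\<not> q \<bottom> p" using p'(4)[OF sq] p' q less.prems QP by (auto simp: perp_def)
      ultimately show ?thesis using q by blast
    qed
  qed
qed

text \<open>Projection from a point \<open>z\<close> of \<open>X\<close> yields a smaller instance
  of the claim. That \<open>g y\<close> depends on \<open>g x\<close> and \<open>Y\<close> is where
  separation enters: a separating point would have a perp containing \<open>x\<close> and
  \<open>X\<close> but not \<open>y\<close>.\<close>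

lemma exchange:
  assumes "finite X" "clique (insert x X)" "y \<in> span (insert x X)" "y \<notin> span X"
  shows "x \<in> span (insert y X)"
  using assms
proof (induction X arbitrary: x y rule: measure_induct_rule[where f = card])
  case (less X)
  note fin = \<open>finite X\<close> and cl = \<open>clique (insert x X)\<close>
  have XP: "insert x X \<subseteq> P" using cl by (simp add: clique_def)
  have sing: "singular P L (span (insert x X))" by (rule singular_span[OF cl])
  have yP: "y \<in> P" using sing less.prems singular_subspace subspace_subset by blast
  show ?case
  proof (cases "X = {}")
    case True
    then show ?thesis using less.prems span_singleton[of x] XP span_inc by auto
  next
    case False
    then obtain z where z: "z \<in> X" by auto
    have zP: "z \<in> P" using z XP by auto
    have yz: "z \<noteq> y" using z less.prems span_inc by blast
    \<comment> \<open>Otherwise \<open>insert x X = X\<close>, and \<open>y\<close> would lie in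
      \<open>span X\<close>.\<close>
    have xz: "z \<noteq> x" using z less.prems by (auto simp: insert_absorb)
    obtain w where w: "w \<in> P" "\<not> z \<bottom> w" using nondegenerate zP by blast
    define C where "C = insert y (insert x X)"
    have Cs: "C \<subseteq> span (insert x X)" unfolding C_def using less.prems(3) span_superset by blast
    have clC: "clique C" using singular_clique[OF sing] Cs clique_subset by blast
    have zC: "z \<in> C" using z by (simp add: C_def)
    obtain g where g: "\<And>y. y \<in> C - {z} \<Longrightarrow> g y \<in> perp z \<inter> perp w"
      "\<And>y S. y \<in> C - {z} \<Longrightarrow> subspace P L S \<Longrightarrow> z \<in> S \<Longrightarrow> y \<in> S \<longleftrightarrow> g y \<in> S"
      using projection_clique[OF clC zC w] by blast
    define Y where "Y = g ` (X - {z})"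
    have xC: "x \<in> C - {z}" and yC: "y \<in> C - {z}" using xz yz by (auto simp: C_def)
    have XC: "X - {z} \<subseteq> C - {z}" by (auto simp: C_def)
    have XP': "X \<subseteq> P" using XP by auto
    have sX: "subspace P L (span X)" by (rule subspace_span[OF XP'])
    have YX: "Y \<subseteq> span X"
      using g(2)[OF _ sX span_inc[OF z]] span_inc XC unfolding Y_def by blast
    have sxX: "subspace P L (span (insert x X))" using sing singular_subspace by blast
    have zs: "z \<in> span (insert x X)" using z span_inc by auto
    have gx: "g x \<in> span (insert x X)" using g(2)[OF xC sxX zs] span_inc by blast
    have "insert (g x) Y \<subseteq> span (insert x X)" using YX gx span_mono[of X "insert x X"] by blast
    then have clY: "clique (insert (g x) Y)" using singular_clique[OF sing] clique_subset by blast
    have finY: "finite Y" using fin by (simp add: Y_def)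
    have "card Y \<le> card (X - {z})" unfolding Y_def using fin by (intro card_image_le) auto
    then have c: "card Y < card X" using fin z by (metis card_Diff1_less le_less_trans)
    have "g y \<in> span (insert (g x) Y)"
    proof (rule ccontr)
      assume n: "g y \<notin> span (insert (g x) Y)"
      have "\<exists>q\<in>P \<inter> perp z \<inter> perp w. (\<forall>u\<in>insert (g x) Y. q \<bottom> u) \<and> \<not> q \<bottom> g y"
      proof (rule perp_separates_span[OF _ _ clY _ _ n])
        show "finite (insert (g x) Y)" using finY by simp
        show "nondegenerate_subspace (P \<inter> perp z \<inter> perp w)"
          by (rule nondegenerate_subspace_perp[OF nondegenerate_subspace_points zP w])
        show "insert (g x) Y \<subseteq> P \<inter> perp z \<inter> perp w"
          using g(1)[OF xC] g(1) XC unfolding Y_def perp_def by blast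
        show "g y \<in> P \<inter> perp z \<inter> perp w" using g(1)[OF yC] by (auto simp: perp_def)
      qed
      then obtain q where q: "q \<in> P" "q \<bottom> z" "q \<bottom> g x" "\<And>u. u \<in> X - {z} \<Longrightarrow> q \<bottom> g u" "\<not> q \<bottom> g y"
        using collinear_sym unfolding perp_def Y_def by blast
      \<comment> \<open>Separation was applied relative to the perp of \<open>z\<close> and
        \<open>w\<close>, so \<open>z\<close> lies in \<open>perp q\<close>, and
        \<open>perp q\<close> cannot tell a point from its projection from \<open>z\<close>.\<close>
      have sq: "subspace P L (perp q)" "z \<in> perp q" using subspace_perp q zP by (auto simp: perp_def)
      have "u \<in> perp q" if "u \<in> X - {z}" for u
        using g(2)[OF _ sq] g(1)[of u] q(4)[of u] that XC unfolding perp_def by blast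
      moreover have "x \<in> perp q" using g(2)[OF xC sq] g(1)[OF xC] q unfolding perp_def by blast
      ultimately have "insert x X \<subseteq> perp q" using sq by blast
      then have "y \<in> perp q" using span_least[OF sq(1)] less.prems by blast
      then show False using g(2)[OF yC sq] q unfolding perp_def by blast
    qed
    moreover have "g y \<notin> span Y"
      using span_subset_span[OF YX XP'] g(2)[OF yC sX span_inc[OF z]] less.prems by blast
    ultimately have "g x \<in> span (insert (g y) Y)" using less.IH[OF c finY clY] by blast
    moreover have yXP: "insert y X \<subseteq> P" using yP XP by auto
    have syX: "subspace P L (span (insert y X))" by (rule subspace_span[OF yXP])
    have zs': "z \<in> span (insert y X)" using z span_inc by auto
    have "insert (g y) Y \<subseteq> span (insert y X)"
      using g(2)[OF yC syX zs'] YX span_mono[of X "insert y X"] span_inc[of y "insert y X"] by blast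
    ultimately have "g x \<in> span (insert y X)" using span_subset_span[OF _ yXP] by blast
    then show ?thesis using g(2)[OF xC syX zs'] by blast
  qed
qed

section \<open>Rank of singular subspaces\<close>

text \<open>If an old point \<open>z\<close> became dependent, exchanging it with \<open>y\<close>
  would put \<open>y\<close> into the span of \<open>X\<close>.\<close>

lemma independent_insert:
  assumes fin: "finite X" and cl: "clique (insert y X)" and ind: "independent P L X" and y: "y \<notin> span X"
  shows "independent P L (insert y X)"
proof -
  have yX: "y \<notin> X" using y span_superset[of X] by blast
  have XP: "insert y X \<subseteq> P" using cl by (simp add: clique_def)
  have ind': "\<And>z. z \<in> X \<Longrightarrow> z \<notin> span (X - {z})" using ind XP by (subst (asm) independent_iff) auto
  have "z \<notin> span (insert y X - {z})" if z: "z \<in> insert y X" for z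
  proof (cases "z = y")
    case True then show ?thesis using y yX by simp
  next
    case False
    then have zX: "z \<in> X" using z by simp
    have eq: "insert y X - {z} = insert y (X - {z})" using False by auto
    have cl': "clique (insert y (X - {z}))" by (rule clique_subset[OF cl]) auto
    show ?thesis
    proof
      assume "z \<in> span (insert y X - {z})"
      then have "z \<in> span (insert y (X - {z}))" by (simp only: eq)
      then have "y \<in> span (insert z (X - {z}))"
        using exchange[OF _ cl', of z] ind'[OF zX] fin by blast
      then show False using y zX by (simp add: insert_absorb)
    qed
  qed
  then show ?thesis by (simp add: independent_iff[OF XP])
qed

lemma independent_subset:
  assumes "independent P L X" "Y \<subseteq> X" shows "independent P L Y"
proof -
  have X: "X \<subseteq> P" and Y: "Y \<subseteq> P" using assms by (auto simp: independent_def)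
  have "y \<notin> span (Y - {y})" if "y \<in> Y" for y
    using assms that span_mono[of "Y - {y}" "X - {y}"] independent_iff[OF X] by blast
  then show ?thesis by (simp add: independent_iff[OF Y])
qed

text \<open>Steinitz exchange: a point of \<open>X\<close> outside \<open>Y\<close> is replaced by a
  point of \<open>Y\<close>, keeping independence and size, until \<open>X\<close> lies inside
  \<open>Y\<close>.\<close>

lemma card_independent_le:
  assumes "finite X" "independent P L X" "X \<subseteq> span Y" "finite Y" "clique Y"
  shows "card X \<le> card Y"
  using assms
proof (induction X rule: measure_induct_rule[where f = "\<lambda>X. card (X - Y)"])
  case (less X)
  note fin = \<open>finite X\<close> and ind = \<open>independent P L X\<close> and cl = \<open>clique Y\<close>
  have XP: "X \<subseteq> P" using ind by (simp add: independent_def)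
  show ?case
  proof (cases "X \<subseteq> Y")
    case True then show ?thesis using less.prems card_mono by blast
  next
    case False
    then obtain x where x: "x \<in> X" "x \<notin> Y" by auto
    have xn: "x \<notin> span (X - {x})" using ind x independent_iff[OF XP] by blast
    have "\<not> Y \<subseteq> span (X - {x})"
    proof
      assume "Y \<subseteq> span (X - {x})"
      then have "span Y \<subseteq> span (X - {x})" using XP by (intro span_subset_span) auto
      then show False using xn x less.prems(3) by blast
    qed
    then obtain y where y: "y \<in> Y" "y \<notin> span (X - {x})" by blast
    define Z where "Z = insert y (X - {x})"
    have yX: "y \<notin> X - {x}" using y(2) span_superset[of "X - {x}"] by blast
    have ZY: "Z \<subseteq> span Y" using y less.prems(3) span_superset[of Y] unfolding Z_def by blast
    have clZ: "clique Z" by (rule clique_subset[OF singular_clique[OF singular_span[OF cl]] ZY])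
    have "independent P L Z" unfolding Z_def
      using independent_insert[OF _ _ independent_subset[OF ind] y(2)] fin clZ by (simp add: Z_def)
    moreover have "Z - Y \<subset> X - Y" using x y by (auto simp: Z_def)
    then have "card (Z - Y) < card (X - Y)" using fin by (intro psubset_card_mono) auto
    moreover have "finite Z" using fin by (simp add: Z_def)
    ultimately have "card Z \<le> card Y" using less.IH[of Z] ZY less.prems by blast
    moreover have "card Z = card X" using fin yX x unfolding Z_def
      by (metis card.insert card.remove finite_Diff)
    ultimately show ?thesis by simp
  qed
qed

text \<open>Zorn's lemma applies because a nonempty chain of singular subspaces is finite and hence
  contains its union.\<close>

lemma maximal_singular_in_family:
  assumes "A \<subseteq> {S. singular P L S}" "A \<noteq> {}"
  shows "\<exists>M\<in>A. \<forall>X\<in>A. M \<subseteq> X \<longrightarrow> X = M"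
proof (rule subset_Zorn_nonempty[OF assms(2)])
  fix C assume C: "C \<noteq> {}" "subset.chain A C"
  then have "subset.chain {S. singular P L S} C" using assms(1) by (auto simp: subset.chain_def)
  then have "finite C" by (rule finite_flags)
  then have "\<Union>C \<in> C" using Union_in_chain C by blast
  then show "\<Union>C \<in> A" using C by (auto simp: subset.chain_def)
qed

definition basis :: "'a set \<Rightarrow> 'a set \<Rightarrow> bool" where
  "basis X S \<longleftrightarrow> finite X \<and> independent P L X \<and> span X = S"

text \<open>Among the spans of finite independent subsets of \<open>S\<close> a maximal one is all
  of \<open>S\<close>, since a point left over could be added.\<close>

lemma basis_exists:
  assumes "singular P L S" shows "\<exists>X. basis X S"
proof -
  define A where "A = {span X | X. finite X \<and> independent P L X \<and> X \<subseteq> S}"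
  have "independent P L {}" by (simp add: independent_def)
  then have "A \<noteq> {}" unfolding A_def by blast
  moreover have "A \<subseteq> {S. singular P L S}"
    unfolding A_def using singular_span clique_subset[OF singular_clique[OF assms]] by blast
  ultimately obtain T where T: "T \<in> A" "\<forall>X\<in>A. T \<subseteq> X \<longrightarrow> X = T" using maximal_singular_in_family by blast
  then obtain X where X: "T = span X" "finite X" "independent P L X" "X \<subseteq> S" by (auto simp: A_def)
  have "S \<subseteq> span X"
  proof
    fix s assume s: "s \<in> S"
    show "s \<in> span X"
    proof (rule ccontr)
      assume n: "s \<notin> span X"
      have "clique (insert s X)"
        by (rule clique_subset[OF singular_clique[OF assms]]) (use s X in auto)
      then have "independent P L (insert s X)" by (rule independent_insert[OF X(2) _ X(3) n])
      then have "span (insert s X) \<in> A" unfolding A_def using X s by blast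
      then have "span (insert s X) = span X" using T X span_mono[of X "insert s X"] by blast
      then show False using n span_superset[of "insert s X"] by blast
    qed
  qed
  moreover have "span X \<subseteq> S" using span_least assms X singular_subspace by blast
  ultimately show ?thesis using X by (auto simp: basis_def)
qed

lemma basis_clique: "singular P L S \<Longrightarrow> basis X S \<Longrightarrow> clique X"
  using singular_clique clique_subset span_superset unfolding basis_def by blast

text \<open>The analogue of vector space dimension, one more than the projective dimension of
  \<open>has_dim\<close>. By \<open>rk_basis\<close> the chosen basis does not matter for singular
  \<open>S\<close>.\<close>

definition rk :: "'a set \<Rightarrow> nat" where
  "rk S = card (SOME X. basis X S)"

lemma rk_basis:
  assumes "singular P L S" "basis X S" shows "rk S = card X"
proof -
  have Y: "basis (SOME X. basis X S) S" using assms(2) by (rule someI)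
  have le: "card U \<le> card V" if "basis U S" "basis V S" for U V
    using card_independent_le[of U V] basis_clique[OF assms(1) that(2)] that span_superset[of U]
    by (simp add: basis_def)
  show ?thesis unfolding rk_def using le[OF Y assms(2)] le[OF assms(2) Y] by simp
qed

text \<open>All bases of \<open>S\<close> have the same size, so each of them attains the minimum in
  \<open>has_dim\<close>.\<close>

lemma has_dim_iff_rk:
  assumes "singular P L S" shows "has_dim P L S k \<longleftrightarrow> int (rk S) = k + 1"
proof -
  obtain X where X: "basis X S" using basis_exists[OF assms] by blast
  have "has_dim P L S k \<longleftrightarrow> (\<exists>X. basis X S \<and> int (card X) = k + 1) \<and> (\<forall>X. basis X S \<longrightarrow> k + 1 \<le> int (card X))"
    unfolding has_dim_def basis_def by (simp only: conj_assoc)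
  also have "\<dots> \<longleftrightarrow> int (rk S) = k + 1"
  proof (intro iffI conjI allI impI)
    show "int (rk S) = k + 1" if "(\<exists>X. basis X S \<and> int (card X) = k + 1) \<and> (\<forall>X. basis X S \<longrightarrow> k + 1 \<le> int (card X))"
      using that rk_basis[OF assms] by auto
    assume k: "int (rk S) = k + 1"
    show "\<exists>X. basis X S \<and> int (card X) = k + 1" using k X rk_basis[OF assms X] by auto
    show "k + 1 \<le> int (card Y)" if "basis Y S" for Y using k rk_basis[OF assms that] by simp
  qed
  finally show ?thesis .
qed

lemma rk_insert:
  assumes S: "singular P L S" and p: "p \<in> P" "\<And>s. s \<in> S \<Longrightarrow> p \<bottom> s" "p \<notin> S"
  shows "singular P L (span (insert p S))" "rk (span (insert p S)) = rk S + 1"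
proof -
  obtain X where X: "basis X S" using basis_exists[OF S] by blast
  have X': "finite X" "independent P L X" "span X = S" "X \<subseteq> P"
    using X by (auto simp: basis_def independent_def)
  have cl: "clique (insert p X)"
    using clique_insert[OF basis_clique[OF S X] p(1)] p(2) X'(3) span_superset[of X] by blast
  show sing: "singular P L (span (insert p S))"
    using singular_span clique_insert[OF singular_clique[OF S] p(1,2)] by blast
  have "span (insert p S) \<subseteq> span (insert p X)"
    using X' p(1) span_mono[of X "insert p X"] span_inc[of p "insert p X"] by (intro span_subset_span) auto
  moreover have "span (insert p X) \<subseteq> span (insert p S)"
    using X'(3) span_superset[of X] by (intro span_mono) auto
  ultimately have "basis (insert p X) (span (insert p S))"
    using independent_insert[OF X'(1) cl X'(2)] p(3) X' by (auto simp: basis_def)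
  then have "rk (span (insert p S)) = card (insert p X)" by (rule rk_basis[OF sing])
  moreover have "p \<notin> X" using p(3) X'(3) span_superset[of X] by blast
  ultimately show "rk (span (insert p S)) = rk S + 1" using X' rk_basis[OF S X] by simp
qed

section \<open>Rank inequalities for singular subspaces\<close>

lemma rk_mono:
  assumes "singular P L S" "singular P L T" "S \<subseteq> T" shows "rk S \<le> rk T"
proof -
  obtain X Y where XY: "basis X S" "basis Y T" using basis_exists assms by blast
  then have "card X \<le> card Y"
    using card_independent_le[of X Y] basis_clique[OF assms(2)] assms(3) span_superset[of X]
    by (auto simp: basis_def)
  then show ?thesis using rk_basis assms XY by metis
qed

lemma rk_subset_eq:
  assumes "singular P L S" "singular P L T" "S \<subseteq> T" "rk T \<le> rk S" shows "S = T"
proof (rule ccontr)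
  assume "S \<noteq> T"
  then obtain t where t: "t \<in> T" "t \<notin> S" using assms by auto
  have tP: "t \<in> P" using t assms singular_subspace subspace_subset by blast
  have tS: "t \<bottom> s" if "s \<in> S" for s using t assms that by (auto simp: singular_def)
  note * = rk_insert[OF assms(1) tP tS t(2)]
  have "span (insert t S) \<subseteq> T" using span_least assms t singular_subspace by blast
  then show False using rk_mono[OF *(1) assms(2)] *(2) assms(4) by simp
qed

text \<open>A perp contains a singular subspace or cuts it in a hyperplane: given \<open>u\<close>
  in \<open>S\<close> outside \<open>perp p\<close>, every other point of \<open>S\<close> projects
  into \<open>perp p\<close> along a line through \<open>u\<close>.\<close>

lemma rk_perp:
  assumes S: "singular P L S" and p: "p \<in> P" shows "rk S \<le> rk (S \<inter> perp p) + 1"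
proof (cases "S \<subseteq> perp p")
  case True then show ?thesis by (simp add: Int_absorb2)
next
  case False
  then obtain u where u: "u \<in> S" "u \<notin> perp p" by auto
  have SP: "S \<subseteq> P" using S singular_subspace subspace_subset by blast
  have uP: "u \<in> P" "\<not> u \<bottom> p" using u SP collinear_sym by (auto simp: perp_def)
  let ?H = "S \<inter> perp p"
  have H: "singular P L ?H" using S p singular_Int subspace_perp by blast
  have uH: "u \<bottom> s" if "s \<in> ?H" for s using S u that by (auto simp: singular_def)
  have un: "u \<notin> ?H" using u by blast
  note * = rk_insert[OF H uP(1) uH un]
  have "S \<subseteq> span (insert u ?H)"
  proof
    fix s assume s: "s \<in> S"
    show "s \<in> span (insert u ?H)"
    proof (cases "s = u")
      case True then show ?thesis using span_inc[of u "insert u ?H"] by simp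
    next
      case False
      have us: "u \<bottom> s" using S s u by (simp add: singular_def)
      obtain s' where s': "s' \<in> P" "p \<bottom> s'"
        "\<And>T. subspace P L T \<Longrightarrow> u \<in> T \<Longrightarrow> s \<in> T \<longleftrightarrow> s' \<in> T"
        using projection[OF uP(1) p uP(2) us] False by blast
      have "s' \<in> ?H" using s' s'(3)[OF singular_subspace[OF S] u(1)] s by (simp add: perp_def)
      then show ?thesis using s'(3)[OF singular_subspace[OF *(1)]] span_superset[of "insert u ?H"] by blast
    qed
  qed
  then show ?thesis using rk_mono[OF S *(1)] *(2) by simp
qed

section \<open>Maximal singular subspaces and opposite bases\<close>

lemma maximal_singular_above:
  assumes "singular P L S" shows "\<exists>T. maximal_singular P L T \<and> S \<subseteq> T"
proof -
  obtain T where "T \<in> {T. singular P L T \<and> S \<subseteq> T}"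
    "\<forall>X\<in>{T. singular P L T \<and> S \<subseteq> T}. T \<subseteq> X \<longrightarrow> X = T"
    using maximal_singular_in_family[of "{T. singular P L T \<and> S \<subseteq> T}"] assms by blast
  then show ?thesis unfolding maximal_singular_def by blast
qed

lemma maximal_singular_singular: "maximal_singular P L S \<Longrightarrow> singular P L S"
  by (simp add: maximal_singular_def)

lemma maximal_singular_perp:
  assumes S: "maximal_singular P L S" and p: "p \<in> P" "\<And>s. s \<in> S \<Longrightarrow> p \<bottom> s"
  shows "p \<in> S"
proof -
  have "singular P L (span (insert p S))"
    using singular_span clique_insert[OF singular_clique[OF maximal_singular_singular[OF S]] p] by blast
  then have "span (insert p S) = S" using S span_superset[of "insert p S"]
    unfolding maximal_singular_def by blast
  then show ?thesis using span_superset[of "insert p S"] by blast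
qed

text \<open>After choosing an opposite point of one basis vector, the remaining ones are
  treated inside the perp of that hyperbolic pair.\<close>

lemma opposite_basis_exists:
  assumes "finite X" "nondegenerate_subspace Q" "clique X" "independent P L X" "X \<subseteq> Q"
  shows "\<exists>g. (\<forall>x\<in>X. g x \<in> Q) \<and> (\<forall>x\<in>X. \<forall>y\<in>X. g x \<bottom> g y \<and> (x \<bottom> g y \<longleftrightarrow> x \<noteq> y))"
  using assms
proof (induction X arbitrary: Q rule: finite_induct)
  case empty then show ?case by simp
next
  case (insert x X)
  note cl = \<open>clique (insert x X)\<close>
  have QP: "Q \<subseteq> P" using insert.prems by (auto simp: nondegenerate_subspace_def subspace_def)
  have ind: "independent P L X" by (rule independent_subset[OF insert.prems(3)]) auto
  have "x \<notin> span (insert x X - {x})"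
    using insert.prems independent_iff[of "insert x X"] by (auto simp: clique_def)
  then have xn: "x \<notin> span X" using insert.hyps by simp
  have clX: "clique X" by (rule clique_subset[OF cl]) auto
  have xX: "x \<in> Q" "X \<subseteq> Q" using insert.prems by auto
  \<comment> \<open>The point opposite to \<open>x\<close>; as it is collinear with the rest of the
    basis, \<open>X\<close> lies in the perp of the pair \<open>x\<close>, \<open>c\<close>.\<close>
  obtain c where c: "c \<in> Q" "\<And>y. y \<in> X \<Longrightarrow> c \<bottom> y" "\<not> c \<bottom> x"
    using perp_separates_span[OF insert.hyps(1) insert.prems(1) clX xX(2,1) xn] by blast
  have xc: "\<not> x \<bottom> c" using c collinear_sym by blast
  let ?Q = "Q \<inter> perp x \<inter> perp c"
  have nd: "nondegenerate_subspace ?Q"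
    using nondegenerate_subspace_perp[OF insert.prems(1) xX(1) c(1) xc] .
  have XQ: "X \<subseteq> ?Q" using xX c QP cl by (auto simp: perp_def clique_def)
  obtain g where g: "\<And>y. y \<in> X \<Longrightarrow> g y \<in> ?Q"
    "\<And>y z. y \<in> X \<Longrightarrow> z \<in> X \<Longrightarrow> g y \<bottom> g z \<and> (y \<bottom> g z \<longleftrightarrow> y \<noteq> z)"
    using insert.IH[OF nd clX ind XQ] by blast
  define h where "h = g(x := c)"
  have hx: "h x = c" and hy: "\<And>y. y \<in> X \<Longrightarrow> h y = g y \<and> y \<noteq> x" using insert.hyps by (auto simp: h_def)
  have gQ: "g y \<in> Q" "x \<bottom> g y" "c \<bottom> g y" "g y \<bottom> c" if "y \<in> X" for y
    using g(1)[OF that] collinear_sym by (auto simp: perp_def)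
  have cc: "c \<bottom> c" "\<And>y. y \<in> X \<Longrightarrow> y \<bottom> c" using c QP collinear_refl collinear_sym by blast+
  show ?case
    by (rule exI[of _ h]) (use hx hy gQ cc c xc g(2) in auto)
qed

end

section \<open>Distance between maximal singular subspaces\<close>

locale ranked_polar_space = polar_space P L for P :: "'a set" and L :: "'a set set" +
  fixes n :: nat
  assumes rank: "has_rank P L n"
begin

lemma maximal_singular_rk: "maximal_singular P L S \<Longrightarrow> rk S = n"
  using rank has_dim_iff_rk[of S "int n - 1"] by (auto simp: has_rank_def maximal_singular_def)

lemma rk_le: "singular P L S \<Longrightarrow> rk S \<le> n"
  using maximal_singular_above maximal_singular_rk rk_mono maximal_singular_singular by metis

lemma maximal_singular_iff_rk:
  assumes "singular P L S" shows "maximal_singular P L S \<longleftrightarrow> rk S = n"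
  using maximal_singular_rk rk_subset_eq[OF assms] rk_le assms unfolding maximal_singular_def by metis

lemma polar_grassmannian_iff: "S \<in> polar_grassmannian P L k \<longleftrightarrow> singular P L S \<and> int (rk S) = k + 1"
  using has_dim_iff_rk by (auto simp: polar_grassmannian_def)

lemma polar_grassmannian_top_iff: "S \<in> polar_grassmannian P L (int n - 1) \<longleftrightarrow> maximal_singular P L S"
  unfolding polar_grassmannian_iff using maximal_singular_iff_rk maximal_singular_singular by auto

lemma maximal_singular_Int: "maximal_singular P L S \<Longrightarrow> maximal_singular P L T \<Longrightarrow> singular P L (S \<inter> T)"
  by (simp add: singular_Int maximal_singular_singular singular_subspace)

abbreviation E where "E \<equiv> dual_polar_edges P L n"

lemma edge_iff: "(S, T) \<in> E \<longleftrightarrow> maximal_singular P L S \<and> maximal_singular P L T \<and> rk (S \<inter> T) + 1 = n"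
proof -
  have "has_dim P L (S \<inter> T) (int n - 2) \<longleftrightarrow> rk (S \<inter> T) + 1 = n"
    if "maximal_singular P L S" "maximal_singular P L T"
    using has_dim_iff_rk[OF maximal_singular_Int[OF that]] by auto
  then show ?thesis by (auto simp: dual_polar_edges_def polar_grassmannian_top_iff)
qed

text \<open>Any point \<open>p\<close> of \<open>T\<close> outside \<open>S\<close> satisfies
  \<open>S \<inter> T = S \<inter> perp p\<close>, so below \<open>S\<close> intersecting with
  \<open>T\<close> amounts to intersecting with a perp.\<close>

lemma rk_Int_edge:
  assumes e: "(S, T) \<in> E" and U: "singular P L U" "U \<subseteq> S"
  shows "rk U \<le> rk (U \<inter> T) + 1"
proof -
  have S: "maximal_singular P L S" and T: "maximal_singular P L T" and r: "rk (S \<inter> T) + 1 = n"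
    using e by (auto simp: edge_iff)
  note sS = maximal_singular_singular[OF S] and sT = maximal_singular_singular[OF T]
  have "\<not> T \<subseteq> S" using r maximal_singular_rk[OF T] by (auto simp: Int_absorb1)
  then obtain p where p: "p \<in> T" "p \<notin> S" by auto
  have pP: "p \<in> P" using p sT singular_subspace subspace_subset by blast
  have sp: "singular P L (S \<inter> perp p)" using sS pP singular_Int subspace_perp by blast
  have sub: "S \<inter> T \<subseteq> S \<inter> perp p"
    using singular_collinear[OF sT p(1)] singular_subset[OF sT] by (auto simp: perp_def)
  \<comment> \<open>By maximality \<open>S\<close> is not inside \<open>perp p\<close>, so
    \<open>S \<inter> perp p\<close> has rank below \<open>n\<close> and cannot exceed
    \<open>S \<inter> T\<close>, which has rank \<open>n - 1\<close>.\<close>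
  have "\<not> S \<subseteq> perp p" using maximal_singular_perp[OF S pP] p by (auto simp: perp_def)
  then have "rk (S \<inter> perp p) \<noteq> rk S" using rk_subset_eq[OF sp sS] by auto
  then have "rk (S \<inter> perp p) < n" using rk_mono[OF sp sS] maximal_singular_rk[OF S] by auto
  then have "S \<inter> T = S \<inter> perp p"
    using rk_subset_eq[OF maximal_singular_Int[OF S T] sp sub] r by simp
  then have "U \<inter> T = U \<inter> perp p" using U by blast
  then show ?thesis using rk_perp[OF U(1) pP] by simp
qed

text \<open>Stated for any \<open>U\<close> below \<open>S\<close>, because the geodesic argument
  for embeddings follows the intersection of two maximal singular subspaces along a walk.\<close>

lemma rk_Int_walk:
  assumes "(S, T) \<in> E ^^ k" "singular P L U" "U \<subseteq> S"
  shows "rk U \<le> rk (U \<inter> T) + k"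
  using assms
proof (induction k arbitrary: S U)
  case 0 then show ?case by (auto simp: Int_absorb2)
next
  case (Suc k)
  obtain B where B: "(S, B) \<in> E" "(B, T) \<in> E ^^ k" using Suc.prems relpow_Suc_D2 by metis
  have sB: "subspace P L B"
    using B(1) maximal_singular_singular singular_subspace by (auto simp: edge_iff)
  have sU: "singular P L (U \<inter> B)" using Suc.prems sB singular_Int by blast
  \<comment> \<open>The walk ends at the end of its last edge, which is a maximal singular
    subspace.\<close>
  have "subspace P L T"
  proof (cases k)
    case 0 then show ?thesis using B sB by simp
  next
    case (Suc j)
    then obtain C where "(C, T) \<in> E" using B(2) by auto
    then show ?thesis using maximal_singular_singular singular_subspace by (auto simp: edge_iff)
  qed
  then have "rk (U \<inter> B \<inter> T) \<le> rk (U \<inter> T)"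
    using sU Suc.prems singular_Int by (intro rk_mono) blast+
  moreover have "rk (U \<inter> B) \<le> rk (U \<inter> B \<inter> T) + k" using Suc.IH[OF B(2) sU] by auto
  moreover have "rk U \<le> rk (U \<inter> B) + 1" using rk_Int_edge[OF B(1)] Suc.prems by auto
  ultimately show ?case by simp
qed

text \<open>If \<open>T\<close> has a point \<open>t\<close> outside \<open>S\<close>, the span of
  \<open>t\<close> and \<open>S \<inter> perp t\<close> is a neighbour of \<open>S\<close>
  containing \<open>t\<close> and \<open>S \<inter> T\<close>, so it meets \<open>T\<close> in
  larger rank. The bound \<open>k \<le> j\<close> lets the walk end early.\<close>

lemma walk_exists:
  assumes "maximal_singular P L S" "maximal_singular P L T" "n \<le> rk (S \<inter> T) + j"
  shows "\<exists>k\<le>j. (S, T) \<in> E ^^ k"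
  using assms
proof (induction j arbitrary: S)
  case 0
  have "S \<inter> T = S"
    using rk_subset_eq[OF maximal_singular_Int[OF 0(1,2)] maximal_singular_singular[OF 0(1)]]
      maximal_singular_rk[OF 0(1)] 0(3) by simp
  then have "S = T" using 0 by (auto simp: maximal_singular_def)
  then show ?case by (intro exI[of _ 0]) auto
next
  case (Suc j)
  note S = Suc.prems(1) and T = Suc.prems(2)
  note sS = maximal_singular_singular[OF S] and sT = maximal_singular_singular[OF T]
  show ?case
  proof (cases "T \<subseteq> S")
    case True
    then have "S = T" using S T by (auto simp: maximal_singular_def)
    then show ?thesis by (intro exI[of _ 0]) auto
  next
    case False
    then obtain t where t: "t \<in> T" "t \<notin> S" by auto
    have tP: "t \<in> P" using t sT singular_subspace subspace_subset by blast
    let ?H = "S \<inter> perp t"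
    define S' where "S' = span (insert t ?H)"
    have H: "singular P L ?H" using sS tP singular_Int subspace_perp by blast
    have tH: "t \<notin> ?H" "\<And>s. s \<in> ?H \<Longrightarrow> t \<bottom> s" using t by (auto simp: perp_def)
    have S': "singular P L S'" "rk S' = rk ?H + 1"
      unfolding S'_def using rk_insert[OF H tP tH(2,1)] by auto
    have rH: "n \<le> rk ?H + 1" using rk_perp[OF sS tP] maximal_singular_rk[OF S] by simp
    have mS': "maximal_singular P L S'"
      using maximal_singular_iff_rk[OF S'(1)] S'(2) rH rk_le[OF S'(1)] by simp
    have HS': "insert t ?H \<subseteq> S'" unfolding S'_def by (rule span_superset)
    have SS': "singular P L (S \<inter> S')" by (rule maximal_singular_Int[OF S mS'])
    have "rk (S \<inter> S') < n"
      using rk_subset_eq[OF SS' S'(1)] maximal_singular_rk[OF mS'] rk_le[OF SS'] HS' t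
      by (metis IntD1 Int_lower2 insert_subset le_neq_implies_less)
    moreover have "rk ?H \<le> rk (S \<inter> S')" using HS' by (intro rk_mono[OF H SS']) auto
    ultimately have e: "(S, S') \<in> E" using S mS' rH by (simp add: edge_iff)
    have ST: "singular P L (S \<inter> T)" by (rule maximal_singular_Int[OF S T])
    have tST: "t \<notin> S \<inter> T" "\<And>s. s \<in> S \<inter> T \<Longrightarrow> t \<bottom> s" using t sT by (auto simp: singular_def)
    have STH: "S \<inter> T \<subseteq> ?H" using tST(2) singular_subset[OF sS] by (auto simp: perp_def)
    have TS': "singular P L (S' \<inter> T)" by (rule maximal_singular_Int[OF mS' T])
    have "span (insert t (S \<inter> T)) \<subseteq> S' \<inter> T"
      using HS' STH t by (intro span_least singular_subspace[OF TS']) auto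
    then have "rk (S \<inter> T) + 1 \<le> rk (S' \<inter> T)"
      using rk_insert[OF ST tP tST(2,1)] rk_mono[OF _ TS'] by metis
    then obtain k where k: "k \<le> j" "(S', T) \<in> E ^^ k" using Suc.IH[OF mS' T] Suc.prems(3) by auto
    then have "(S, T) \<in> E ^^ Suc k" using e by (intro relpow_Suc_I2)
    then show ?thesis using k(1) Suc_le_mono by blast
  qed
qed

end

text \<open>A finite value forces some walk to exist, and the infimum of a nonempty set in
  \<open>enat\<close> is attained.\<close>

lemma graph_dist_eq_iff:
  "graph_dist R u v = enat d \<longleftrightarrow> (u, v) \<in> R ^^ d \<and> (\<forall>k. (u, v) \<in> R ^^ k \<longrightarrow> d \<le> k)"
proof -
  let ?A = "enat ` {k. (u, v) \<in> R ^^ k}"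
  show ?thesis
  proof
    assume d: "graph_dist R u v = enat d"
    then have ne: "?A \<noteq> {}" by (auto simp: graph_dist_def Inf_enat_def split: if_splits)
    then obtain a where "a \<in> ?A" by blast
    then have "(LEAST x. x \<in> ?A) \<in> ?A" by (rule LeastI)
    then have "Inf ?A \<in> ?A" using ne unfolding Inf_enat_def by (simp only: if_False)
    then have "(u, v) \<in> R ^^ d" using d by (auto simp: graph_dist_def)
    moreover have "d \<le> k" if "(u, v) \<in> R ^^ k" for k
    proof -
      have "Inf ?A \<le> enat k" using that by (intro Inf_lower) auto
      then show ?thesis using d by (simp add: graph_dist_def)
    qed
    ultimately show "(u, v) \<in> R ^^ d \<and> (\<forall>k. (u, v) \<in> R ^^ k \<longrightarrow> d \<le> k)" by blast
  next
    assume *: "(u, v) \<in> R ^^ d \<and> (\<forall>k. (u, v) \<in> R ^^ k \<longrightarrow> d \<le> k)"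
    have "Inf ?A = enat d"
      by (rule antisym) (use * in \<open>auto intro: Inf_lower Inf_greatest\<close>)
    then show "graph_dist R u v = enat d" by (simp add: graph_dist_def)
  qed
qed

text \<open>A walk of length \<open>d\<close> loses at most \<open>d\<close> in rank, and
  \<open>walk_exists\<close> supplies a walk no longer than the corank of the intersection.\<close>

lemma (in ranked_polar_space) graph_dist_rk:
  assumes S: "maximal_singular P L S" and T: "maximal_singular P L T" and d: "graph_dist E S T = enat d"
  shows "(S, T) \<in> E ^^ d" "rk (S \<inter> T) + d = n"
proof -
  show w: "(S, T) \<in> E ^^ d" using d by (simp add: graph_dist_eq_iff)
  have "n \<le> rk (S \<inter> T) + d"
    using rk_Int_walk[OF w maximal_singular_singular[OF S] order_refl] maximal_singular_rk[OF S] by simp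
  moreover have "n \<le> rk (S \<inter> T) + (n - rk (S \<inter> T))" by simp
  from walk_exists[OF S T this] obtain k where k: "k \<le> n - rk (S \<inter> T)" "(S, T) \<in> E ^^ k" by blast
  then have "d \<le> n - rk (S \<inter> T)" using d order_trans unfolding graph_dist_eq_iff by blast
  moreover have "rk (S \<inter> T) \<le> n" by (rule rk_le[OF maximal_singular_Int[OF S T]])
  ultimately show "rk (S \<inter> T) + d = n" by simp
qed

section \<open>The hypercube graph\<close>

text \<open>The ground set of \<open>no_opposite_pair\<close>, in a form that is visibly closed
  under negation.\<close>

definition signed_indices :: "nat \<Rightarrow> int set" where
  "signed_indices m = {i. i \<noteq> 0 \<and> \<bar>i\<bar> \<le> int m}"

lemma signed_indices_eq: "signed_indices m = {1..int m} \<union> {- int m..-1}"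
  by (auto simp: signed_indices_def)

lemma finite_signed_indices: "finite (signed_indices m)"
  by (simp add: signed_indices_eq)

lemma card_signed_indices: "card (signed_indices m) = 2 * m"
  unfolding signed_indices_eq by (subst card_Un_disjoint) auto

lemma uminus_signed_indices: "i \<in> signed_indices m \<Longrightarrow> - i \<in> signed_indices m"
  by (simp add: signed_indices_def)

text \<open>If neither \<open>i\<close> nor \<open>- i\<close> were in \<open>X\<close>, then
  \<open>i\<close> could be added; so maximality means one element from each pair.\<close>

lemma hypercube_vertices_iff:
  "X \<in> hypercube_vertices m \<longleftrightarrow>
     X \<subseteq> signed_indices m \<and> (\<forall>i\<in>signed_indices m. i \<in> X \<longleftrightarrow> - i \<notin> X)"
proof -
  have nop: "no_opposite_pair m Y \<longleftrightarrow> Y \<subseteq> signed_indices m \<and> (\<forall>i\<in>Y. - i \<notin> Y)" for Y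
    by (simp add: no_opposite_pair_def signed_indices_eq)
  show ?thesis
  proof
    assume "X \<in> hypercube_vertices m"
    then have X: "X \<subseteq> signed_indices m" "\<forall>i\<in>X. - i \<notin> X"
      and max: "\<And>Y. no_opposite_pair m Y \<Longrightarrow> X \<subseteq> Y \<Longrightarrow> Y = X"
      by (auto simp: hypercube_vertices_def nop)
    have "i \<in> X" if i: "i \<in> signed_indices m" "- i \<notin> X" for i
    proof -
      have "i \<noteq> - i" using i by (auto simp: signed_indices_def)
      then have "no_opposite_pair m (insert i X)" using X i unfolding nop
        by (metis add.inverse_inverse insert_iff insert_subset)
      then show ?thesis using max by blast
    qed
    then show "X \<subseteq> signed_indices m \<and> (\<forall>i\<in>signed_indices m. i \<in> X \<longleftrightarrow> - i \<notin> X)" using X by blast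
  next
    assume X: "X \<subseteq> signed_indices m \<and> (\<forall>i\<in>signed_indices m. i \<in> X \<longleftrightarrow> - i \<notin> X)"
    show "X \<in> hypercube_vertices m" unfolding hypercube_vertices_def nop using X by blast
  qed
qed

lemma hypercube_vertex_subset: "X \<in> hypercube_vertices m \<Longrightarrow> X \<subseteq> signed_indices m"
  by (simp only: hypercube_vertices_iff)

lemma hypercube_vertex_mem:
  "X \<in> hypercube_vertices m \<Longrightarrow> i \<in> signed_indices m \<Longrightarrow> i \<in> X \<longleftrightarrow> - i \<notin> X"
  unfolding hypercube_vertices_iff by blast

lemma hypercube_vertex_opposite:
  assumes "X \<in> hypercube_vertices m" shows "X \<inter> uminus ` X = {}"
  using hypercube_vertex_mem[OF assms] hypercube_vertex_subset[OF assms] by fastforce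

lemma hypercube_vertex_finite: "X \<in> hypercube_vertices m \<Longrightarrow> finite X"
  by (rule finite_subset[OF hypercube_vertex_subset finite_signed_indices])

text \<open>\<open>X\<close> and its negative partition the \<open>2 * m\<close> signed
  indices.\<close>

lemma hypercube_vertex_card:
  assumes X: "X \<in> hypercube_vertices m" shows "card X = m"
proof -
  have "signed_indices m = X \<union> uminus ` X"
  proof
    show "signed_indices m \<subseteq> X \<union> uminus ` X"
      using X unfolding hypercube_vertices_iff by (metis UnCI add.inverse_inverse image_eqI subsetI)
    show "X \<union> uminus ` X \<subseteq> signed_indices m"
      using X uminus_signed_indices unfolding hypercube_vertices_iff by blast
  qed
  moreover have "X \<inter> uminus ` X = {}" by (rule hypercube_vertex_opposite[OF X])
  moreover have "card (uminus ` X) = card X" by (rule card_image) simp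
  ultimately have "2 * m = card X + card X"
    using card_Un_disjoint[of X "uminus ` X"] hypercube_vertex_finite[OF X] card_signed_indices[of m]
    by simp
  then show ?thesis by simp
qed

lemma hypercube_vertex_uminus:
  assumes X: "X \<in> hypercube_vertices m" shows "uminus ` X \<in> hypercube_vertices m"
  unfolding hypercube_vertices_iff
proof (intro conjI ballI)
  have img: "i \<in> uminus ` X \<longleftrightarrow> - i \<in> X" for i by force
  show "uminus ` X \<subseteq> signed_indices m"
    using hypercube_vertex_subset[OF X] uminus_signed_indices by blast
  show "i \<in> uminus ` X \<longleftrightarrow> - i \<notin> uminus ` X" if "i \<in> signed_indices m" for i
    using hypercube_vertex_mem[OF X that] by (simp add: img)
qed

lemma hypercube_vertex_flip:
  assumes "X \<in> hypercube_vertices m" "i \<in> X"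
  shows "insert (- i) (X - {i}) \<in> hypercube_vertices m"
proof -
  have i: "i \<in> signed_indices m" using hypercube_vertex_subset[OF assms(1)] assms(2) by blast
  have i': "- i \<in> signed_indices m" by (rule uminus_signed_indices[OF i])
  have ne: "i \<noteq> - i" using i by (auto simp: signed_indices_def)
  have "j \<in> insert (- i) (X - {i}) \<longleftrightarrow> - j \<notin> insert (- i) (X - {i})" if j: "j \<in> signed_indices m" for j
  proof -
    consider "j = i" | "j = - i" | "j \<noteq> i" "j \<noteq> - i" "- j \<noteq> i" "- j \<noteq> - i" by fastforce
    then show ?thesis using ne hypercube_vertex_mem[OF assms(1) j] by cases auto
  qed
  then show ?thesis
    using hypercube_vertex_subset[OF assms(1)] i' unfolding hypercube_vertices_iff by blast
qed

lemma hypercube_vertex_exists: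
  assumes "i \<in> signed_indices m" shows "\<exists>X\<in>hypercube_vertices m. i \<in> X"
proof -
  have X: "{1..int m} \<in> hypercube_vertices m"
    by (auto simp: hypercube_vertices_iff signed_indices_def)
  show ?thesis
  proof (cases "i > 0")
    case True then show ?thesis using X assms by (intro bexI[OF _ X]) (auto simp: signed_indices_def)
  next
    case False
    then have "- i \<in> {1..int m}" using assms by (auto simp: signed_indices_def)
    then show ?thesis by (intro bexI[OF _ hypercube_vertex_uminus[OF X]]) force
  qed
qed

section \<open>Hamming distance in the hypercube\<close>

lemma hypercube_card_Diff:
  assumes "X \<in> hypercube_vertices m"
  shows "card (X - Y) + card (X \<inter> Y) = m"
  using card_Diff_subset_Int[of X Y] hypercube_vertex_card[OF assms] hypercube_vertex_finite[OF assms]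
    card_mono[of X "X \<inter> Y"] by auto

lemma hypercube_card_Diff_commute:
  assumes "X \<in> hypercube_vertices m" "Y \<in> hypercube_vertices m"
  shows "card (X - Y) = card (Y - X)"
  using hypercube_card_Diff[OF assms(1), of Y] hypercube_card_Diff[OF assms(2), of X]
  by (simp add: Int_commute)

lemma hypercube_edges_iff:
  "(X, Y) \<in> hypercube_edges m \<longleftrightarrow>
     X \<in> hypercube_vertices m \<and> Y \<in> hypercube_vertices m \<and> card (X - Y) = 1"
  using hypercube_card_Diff[of X m Y] by (auto simp: hypercube_edges_def)

text \<open>The number \<open>card (X - Y)\<close> obeys the triangle inequality along walks, and
  changing the sign of an element of \<open>X - Y\<close> lowers it by one.\<close>

lemma hypercube_dist:
  assumes "X \<in> hypercube_vertices m" "Y \<in> hypercube_vertices m"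
  shows "graph_dist (hypercube_edges m) X Y = enat (card (X - Y))"
proof -
  have lower: "card (X - Y) \<le> k" if "(X, Y) \<in> hypercube_edges m ^^ k" "X \<in> hypercube_vertices m" for X k
    using that
  proof (induction k arbitrary: X)
    case 0 then show ?case by simp
  next
    case (Suc k)
    then obtain Z where Z: "(X, Z) \<in> hypercube_edges m" "(Z, Y) \<in> hypercube_edges m ^^ k"
      using relpow_Suc_D2 by metis
    then have ZV: "Z \<in> hypercube_vertices m" "card (X - Z) = 1" by (auto simp: hypercube_edges_iff)
    have "X - Y \<subseteq> (X - Z) \<union> (Z - Y)" by auto
    then have "card (X - Y) \<le> card ((X - Z) \<union> (Z - Y))"
      using hypercube_vertex_finite Suc.prems ZV by (intro card_mono) auto
    also have "\<dots> \<le> card (X - Z) + card (Z - Y)" by (rule card_Un_le)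
    finally show ?case using Suc.IH[OF Z(2) ZV(1)] ZV by simp
  qed
  have upper: "(X, Y) \<in> hypercube_edges m ^^ k"
    if "X \<in> hypercube_vertices m" "card (X - Y) = k" for X k
    using that
  proof (induction k arbitrary: X)
    case 0
    \<comment> \<open>Vertices have equal size, so one empty difference makes the other
      empty.\<close>
    have "card (Y - X) = 0" using 0 hypercube_card_Diff_commute[OF 0(1) assms(2)] by simp
    then have "X - Y = {}" "Y - X = {}"
      using 0 hypercube_vertex_finite[OF assms(2)] hypercube_vertex_finite[OF 0(1)] by simp_all
    then have "X = Y" by blast
    then show ?case by simp
  next
    case (Suc k)
    have "X - Y \<noteq> {}" using Suc.prems(2) by (metis card.empty nat.distinct(1))
    then obtain i where i: "i \<in> X" "i \<notin> Y" by auto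
    let ?Z = "insert (- i) (X - {i})"
    have Z: "?Z \<in> hypercube_vertices m" by (rule hypercube_vertex_flip[OF Suc.prems(1) i(1)])
    have iI: "i \<in> signed_indices m" using hypercube_vertex_subset[OF Suc.prems(1)] i by blast
    have ii: "- i \<noteq> i" "- i \<in> Y"
      using hypercube_vertex_mem[OF assms(2) iI] i iI by (auto simp: signed_indices_def)
    have "X - ?Z = {i}" using i ii by auto
    then have "(X, ?Z) \<in> hypercube_edges m" using Z Suc.prems by (simp add: hypercube_edges_iff)
    moreover have "?Z - Y = X - Y - {i}" using ii by auto
    then have "card (?Z - Y) = k" using Suc.prems i hypercube_vertex_finite by simp
    ultimately show ?case using Suc.IH[OF Z] by (intro relpow_Suc_I2)
  qed
  show ?thesis unfolding graph_dist_eq_iff using lower upper assms by blast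
qed

section \<open>Isometric embeddings of hypercubes\<close>

context ranked_polar_space
begin

lemma span_insert_span: "A \<subseteq> P \<Longrightarrow> p \<in> P \<Longrightarrow> span (insert p (span A)) = span (insert p A)"
proof (rule antisym)
  assume A: "A \<subseteq> P" "p \<in> P"
  show "span (insert p (span A)) \<subseteq> span (insert p A)"
    using A span_mono[of A "insert p A"] span_inc[of p "insert p A"] by (intro span_subset_span) auto
  show "span (insert p A) \<subseteq> span (insert p (span A))"
    using span_superset[of A] by (intro span_mono) auto
qed

lemma span_Un_span: "A \<subseteq> P \<Longrightarrow> B \<subseteq> P \<Longrightarrow> span (span A \<union> B) = span (A \<union> B)"
proof (rule antisym)
  assume A: "A \<subseteq> P" "B \<subseteq> P"
  show "span (span A \<union> B) \<subseteq> span (A \<union> B)"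
    using A span_mono[of A "A \<union> B"] span_superset[of "A \<union> B"] by (intro span_subset_span) auto
  show "span (A \<union> B) \<subseteq> span (span A \<union> B)"
    using span_superset[of A] by (intro span_mono) auto
qed

context
  fixes m :: nat and f :: "int set \<Rightarrow> 'a set"
  assumes iso: "isometric_embedding (hypercube_vertices m) (hypercube_edges m)
                 (polar_grassmannian P L (int n - 1)) E f"
begin

abbreviation V where "V \<equiv> hypercube_vertices m"

lemma embedding_maximal: "X \<in> V \<Longrightarrow> maximal_singular P L (f X)"
  using iso polar_grassmannian_top_iff unfolding isometric_embedding_def by blast

lemma embedding_dist: "X \<in> V \<Longrightarrow> Y \<in> V \<Longrightarrow> graph_dist E (f X) (f Y) = enat (card (X - Y))"
  using iso hypercube_dist unfolding isometric_embedding_def by metis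

lemma embedding_rk: "X \<in> V \<Longrightarrow> Y \<in> V \<Longrightarrow> rk (f X \<inter> f Y) + card (X - Y) = n"
  using graph_dist_rk(2) embedding_maximal embedding_dist by blast

text \<open>The vertices \<open>Z\<close> with \<open>X \<inter> Y \<subseteq> Z\<close> are those on a geodesic from \<open>X\<close> to \<open>Y\<close>. Every step of a
  walk lowers the rank of the intersection by at most one, so along a geodesic no rank is to spare.\<close>

lemma embedding_between:
  assumes X: "X \<in> V" and Y: "Y \<in> V" and Z: "Z \<in> V" and sub: "X \<inter> Y \<subseteq> Z"
  shows "f X \<inter> f Y \<subseteq> f Z"
proof -
  note mX = embedding_maximal[OF X] and mY = embedding_maximal[OF Y] and mZ = embedding_maximal[OF Z]
  have "Z - Y \<subseteq> X"
  proof
    fix z assume z: "z \<in> Z - Y"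
    then have zI: "z \<in> signed_indices m" using hypercube_vertex_subset[OF Z] by blast
    show "z \<in> X"
      using hypercube_vertex_mem[OF X zI] hypercube_vertex_mem[OF Y zI] hypercube_vertex_mem[OF Z zI] z sub
      by blast
  qed
  then have "X - Y = (X - Z) \<union> (Z - Y)" using sub by blast
  then have "card (X - Y) = card ((X - Z) \<union> (Z - Y))" by simp
  also have "\<dots> = card (X - Z) + card (Z - Y)"
    using X Z hypercube_vertex_finite by (intro card_Un_disjoint) auto
  finally have c: "card (X - Y) = card (X - Z) + card (Z - Y)" .
  let ?U = "f Z \<inter> f Y"
  have U: "singular P L ?U" by (rule maximal_singular_Int[OF mZ mY])
  have UX: "singular P L (?U \<inter> f X)"
    using singular_Int[OF U] mX maximal_singular_singular singular_subspace by blast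
  have w: "(f Z, f X) \<in> E ^^ card (Z - X)" by (rule graph_dist_rk(1)[OF mZ mX embedding_dist[OF Z X]])
  have "rk ?U \<le> rk (?U \<inter> f X) + card (Z - X)" by (rule rk_Int_walk[OF w U]) auto
  \<comment> \<open>\<open>?U\<close> has rank \<open>n - card (Z - Y)\<close>; after a loss of at
    most \<open>card (Z - X)\<close> there remains at least \<open>n - card (X - Y)\<close>, the
    rank of \<open>f X \<inter> f Y\<close>.\<close>
  then have "rk (f X \<inter> f Y) \<le> rk (?U \<inter> f X)"
    using embedding_rk[OF X Y] embedding_rk[OF Z Y] c hypercube_card_Diff_commute[OF X Z] by simp
  then have "?U \<inter> f X = f X \<inter> f Y"
    by (intro rk_subset_eq[OF UX maximal_singular_Int[OF mX mY]]) auto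
  then show ?thesis by blast
qed

text \<open>Coordinates for the image: \<open>M\<close> lies in every \<open>f Z\<close> and
  \<open>p i\<close> in those with \<open>i \<in> Z\<close>. A rank count shows that these generate,
  and maximality of the \<open>f Y\<close> settles which \<open>p i\<close> are collinear.\<close>

lemma embedding_structure:
  obtains M p where "singular P L M" "rk M + m = n" "M \<subseteq> P"
    "\<And>i. i \<in> signed_indices m \<Longrightarrow> p i \<in> P"
    "\<And>i j. i \<in> signed_indices m \<Longrightarrow> j \<in> signed_indices m \<Longrightarrow> p i \<bottom> p j \<longleftrightarrow> j \<noteq> - i"
    "\<And>Y. Y \<in> V \<Longrightarrow> f Y = span (M \<union> p ` Y)"
    "\<And>i x. i \<in> signed_indices m \<Longrightarrow> x \<in> M \<Longrightarrow> x \<bottom> p i"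
proof -
  have X0: "{1..int m} \<in> V" by (auto simp: hypercube_vertices_iff signed_indices_def)
  note opp = hypercube_vertex_opposite
  \<comment> \<open>Antipodal vertices are disjoint, so every vertex lies between them; any
    antipodal pair gives the same \<open>M\<close>.\<close>
  define M where "M = f {1..int m} \<inter> f (uminus ` {1..int m})"
  have MZ: "M \<subseteq> f Z" if "Z \<in> V" for Z unfolding M_def
    using embedding_between[OF X0 hypercube_vertex_uminus[OF X0] that] opp[OF X0] by blast
  have Mopp: "f Y \<inter> f (uminus ` Y) = M" if Y: "Y \<in> V" for Y
  proof -
    have "f Y \<inter> f (uminus ` Y) \<subseteq> f Z" if "Z \<in> V" for Z
      using embedding_between[OF Y hypercube_vertex_uminus[OF Y] that] opp[OF Y] by blast
    then have "f Y \<inter> f (uminus ` Y) \<subseteq> M" unfolding M_def using X0 hypercube_vertex_uminus[OF X0] by blast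
    then show ?thesis using MZ[OF Y] MZ[OF hypercube_vertex_uminus[OF Y]] by blast
  qed
  have M: "singular P L M" unfolding M_def
    by (rule maximal_singular_Int[OF embedding_maximal[OF X0] embedding_maximal[OF hypercube_vertex_uminus[OF X0]]])
  have "{1..int m} - uminus ` {1..int m} = {1..int m}" by auto
  then have rM: "rk M + m = n" unfolding M_def
    using embedding_rk[OF X0 hypercube_vertex_uminus[OF X0]] by simp
  have MP: "M \<subseteq> P" by (rule singular_subset[OF M])
  have "\<forall>i\<in>signed_indices m. \<exists>q. q \<notin> M \<and> (\<forall>Z\<in>V. i \<in> Z \<longrightarrow> q \<in> f Z)"
  proof
    fix i assume i: "i \<in> signed_indices m"
    obtain Y where Y: "Y \<in> V" "i \<in> Y" using hypercube_vertex_exists[OF i] by blast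
    \<comment> \<open>The antipode of \<open>Y\<close> with the sign at \<open>i\<close> changed
      back: it meets \<open>Y\<close> in \<open>i\<close> alone, so every vertex containing
      \<open>i\<close> lies between the two.\<close>
    let ?Y = "insert i (uminus ` Y - {- i})"
    have "- i \<in> uminus ` Y" using Y by simp
    then have Y': "?Y \<in> V" using hypercube_vertex_flip[OF hypercube_vertex_uminus[OF Y(1)], of "- i"] by simp
    have YY: "Y \<inter> ?Y = {i}" using opp[OF Y(1)] Y(2) by auto
    have "rk (f Y \<inter> f ?Y) = rk M + 1"
      using embedding_rk[OF Y(1) Y'] hypercube_card_Diff[OF Y(1), of ?Y] YY rM by simp
    moreover have s: "singular P L (f Y \<inter> f ?Y)"
      by (rule maximal_singular_Int[OF embedding_maximal[OF Y(1)] embedding_maximal[OF Y']])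
    ultimately have "\<not> f Y \<inter> f ?Y \<subseteq> M" using rk_mono[OF s M] by auto
    then obtain q where q: "q \<in> f Y \<inter> f ?Y" "q \<notin> M" by blast
    have "q \<in> f Z" if "Z \<in> V" "i \<in> Z" for Z
    proof -
      have "Y \<inter> ?Y \<subseteq> Z" unfolding YY using that(2) by simp
      from embedding_between[OF Y(1) Y' that(1) this] show ?thesis using q(1) by blast
    qed
    then show "\<exists>q. q \<notin> M \<and> (\<forall>Z\<in>V. i \<in> Z \<longrightarrow> q \<in> f Z)" using q(2) by blast
  qed
  from bchoice[OF this] obtain p where p: "\<And>i. i \<in> signed_indices m \<Longrightarrow> p i \<notin> M"
    "\<And>i Z. i \<in> signed_indices m \<Longrightarrow> Z \<in> V \<Longrightarrow> i \<in> Z \<Longrightarrow> p i \<in> f Z" by blast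
  have VI: "i \<in> signed_indices m" if "Y \<in> V" "i \<in> Y" for Y i
    using hypercube_vertex_subset that by blast
  have sing: "singular P L (f Y)" if "Y \<in> V" for Y
    by (rule maximal_singular_singular[OF embedding_maximal[OF that]])
  have pP: "p i \<in> P" if i: "i \<in> signed_indices m" for i
    using hypercube_vertex_exists[OF i] p(2)[OF i] singular_subset[OF sing] by blast
  have pM: "x \<bottom> p i" if i: "i \<in> signed_indices m" "x \<in> M" for i x
  proof -
    obtain Y where Y: "Y \<in> V" "i \<in> Y" using hypercube_vertex_exists[OF i(1)] by blast
    show ?thesis using singular_collinear[OF sing[OF Y(1)]] MZ[OF Y(1)] i(2) p(2)[OF i(1) Y] by blast
  qed
  \<comment> \<open>Otherwise \<open>p k\<close> would lie in the images of both \<open>Z\<close>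
    and its antipode, hence in \<open>M\<close>.\<close>
  have pn: "p k \<notin> f Z" if k: "k \<in> signed_indices m" and Z: "Z \<in> V" "- k \<in> Z" for k Z
  proof
    assume "p k \<in> f Z"
    moreover have "k \<in> uminus ` Z" using Z(2) by force
    then have "p k \<in> f (uminus ` Z)" by (rule p(2)[OF k hypercube_vertex_uminus[OF Z(1)]])
    ultimately show False using Mopp[OF Z(1)] p(1)[OF k] by blast
  qed
  have fY: "f Y = span (M \<union> p ` Y)" if Y: "Y \<in> V" for Y
  proof -
    have pY: "p ` Y \<subseteq> f Y" using p(2)[OF VI[OF Y] Y] by blast
    have sub: "M \<union> p ` Y \<subseteq> f Y" using pY MZ[OF Y] by blast
    have clq: "clique (M \<union> p ` Y)" by (rule clique_subset[OF singular_clique[OF sing[OF Y]] sub])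
    \<comment> \<open>Each further \<open>p k\<close> raises the rank: flipping \<open>k\<close>
      gives a vertex whose image contains \<open>M\<close> and the earlier points but not
      \<open>p k\<close>. At \<open>J = Y\<close> the rank is \<open>n\<close>.\<close>
    have "rk (span (M \<union> p ` J)) = rk M + card J" if "finite J" "J \<subseteq> Y" for J
      using that
    proof (induction J rule: finite_induct)
      case empty
      then show ?case using span_subspace[OF singular_subspace[OF M]] by simp
    next
      case (insert k J)
      have k: "k \<in> Y" "k \<in> signed_indices m" using insert.prems VI[OF Y] by auto
      let ?Z = "insert (- k) (Y - {k})"
      have Z: "?Z \<in> V" by (rule hypercube_vertex_flip[OF Y k(1)])
      have "J \<subseteq> ?Z" using insert by auto
      then have "M \<union> p ` J \<subseteq> f ?Z" using MZ[OF Z] p(2)[OF _ Z] VI[OF Z] by blast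
      then have "span (M \<union> p ` J) \<subseteq> f ?Z" by (rule span_least[OF singular_subspace[OF sing[OF Z]]])
      then have kn: "p k \<notin> span (M \<union> p ` J)" using pn[OF k(2) Z] by blast
      have cJ: "clique (M \<union> p ` J)" by (rule clique_subset[OF clq]) (use insert.prems in auto)
      have "span (M \<union> p ` J) \<subseteq> f Y"
        by (rule span_least[OF singular_subspace[OF sing[OF Y]]]) (use sub insert.prems in auto)
      then have col: "p k \<bottom> s" if "s \<in> span (M \<union> p ` J)" for s
        using singular_collinear[OF sing[OF Y] p(2)[OF k(2) Y k(1)]] that by blast
      have JP: "M \<union> p ` J \<subseteq> P" using cJ by (simp add: clique_def)
      have "span (M \<union> p ` insert k J) = span (insert (p k) (span (M \<union> p ` J)))"
        using span_insert_span[OF JP pP[OF k(2)]] by simp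
      then show ?case using rk_insert(2)[OF singular_span[OF cJ] pP[OF k(2)] col kn] insert by simp
    qed
    from this[OF hypercube_vertex_finite[OF Y] order_refl] have "rk (span (M \<union> p ` Y)) = n"
      using rM hypercube_vertex_card[OF Y] by simp
    then have "span (M \<union> p ` Y) = f Y"
      using rk_subset_eq[OF singular_span[OF clq] sing[OF Y]
          span_least[OF singular_subspace[OF sing[OF Y]] sub]]
        maximal_singular_rk[OF embedding_maximal[OF Y]] by simp
    then show ?thesis by simp
  qed
  have pp: "p i \<bottom> p j" if i: "i \<in> signed_indices m" and j: "j \<in> signed_indices m" "j \<noteq> - i" for i j
  proof -
    obtain Y where Y: "Y \<in> V" "i \<in> Y" using hypercube_vertex_exists[OF i] by blast
    \<comment> \<open>A vertex containing both \<open>i\<close> and \<open>j\<close>: replacing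
      \<open>- j\<close> by \<open>j\<close> keeps \<open>i\<close> because
      \<open>j \<noteq> - i\<close>.\<close>
    define Z where "Z = (if j \<in> Y then Y else insert j (Y - {- j}))"
    have "Z \<in> V \<and> i \<in> Z \<and> j \<in> Z"
    proof (cases "j \<in> Y")
      case True then show ?thesis using Y by (simp add: Z_def)
    next
      case False
      then have "- j \<in> Y" using hypercube_vertex_mem[OF Y(1) j(1)] by blast
      then show ?thesis using hypercube_vertex_flip[OF Y(1), of "- j"] Y(2) j(2) False
        by (auto simp: Z_def)
    qed
    then show ?thesis using singular_collinear[OF sing] p(2) i j by blast
  qed
  \<comment> \<open>Otherwise \<open>p (- i)\<close> would be collinear with all generators of
    \<open>f Y\<close> for a vertex \<open>Y\<close> containing \<open>i\<close>, and maximality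
    would put it into \<open>f Y\<close>, against \<open>pn\<close>.\<close>
  have pnp: "\<not> p i \<bottom> p (- i)" if i: "i \<in> signed_indices m" for i
  proof
    assume c: "p i \<bottom> p (- i)"
    have i': "- i \<in> signed_indices m" by (rule uminus_signed_indices[OF i])
    obtain Y where Y: "Y \<in> V" "i \<in> Y" using hypercube_vertex_exists[OF i] by blast
    have "p (- i) \<bottom> p j" if "j \<in> Y" for j
      using pp[OF i' VI[OF Y(1) that]] c collinear_sym by (cases "j = i") auto
    then have "p (- i) \<bottom> x" if "x \<in> M \<union> p ` Y" for x
      using pM[OF i'] collinear_sym that by blast
    moreover have "M \<union> p ` Y \<subseteq> P" using MP pP[OF VI[OF Y(1)]] by blast
    ultimately have "p (- i) \<bottom> s" if "s \<in> f Y" for s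
      using collinear_span[OF pP[OF i']] that fY[OF Y(1)] by blast
    then have "p (- i) \<in> f Y" by (rule maximal_singular_perp[OF embedding_maximal[OF Y(1)] pP[OF i']])
    then show False using pn[OF i' Y(1)] Y(2) by simp
  qed
  show thesis
    by (rule that[OF M rM MP pP _ fY pM]) (use pp pnp in auto)
qed

end

section \<open>Completion to a frame and identification of the image\<close>

text \<open>The hyperbolic pairs \<open>p k\<close>, \<open>p (- k)\<close> are split off one at a
  time. The opposites of a basis of \<open>M\<close> will be chosen in the remaining
  subspace.\<close>

lemma nondegenerate_subspace_perp_frame:
  assumes "\<And>i. i \<in> signed_indices m \<Longrightarrow> p i \<in> P"
    and "\<And>i j. i \<in> signed_indices m \<Longrightarrow> j \<in> signed_indices m \<Longrightarrow> p i \<bottom> p j \<longleftrightarrow> j \<noteq> - i"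
  shows "nondegenerate_subspace {q \<in> P. \<forall>i\<in>signed_indices m. q \<bottom> p i}"
  using assms
proof (induction m)
  case 0
  have "signed_indices 0 = {}" by (auto simp: signed_indices_def)
  then show ?case using nondegenerate_subspace_points by simp
next
  case (Suc m)
  define k where "k = int (Suc m)"
  have I: "signed_indices (Suc m) = insert k (insert (- k) (signed_indices m))"
    by (auto simp: signed_indices_def k_def)
  have k: "k \<notin> signed_indices m" "- k \<notin> signed_indices m" by (auto simp: signed_indices_def k_def)
  have kI: "k \<in> signed_indices (Suc m)" "- k \<in> signed_indices (Suc m)" by (auto simp: I)
  let ?Q = "{q \<in> P. \<forall>i\<in>signed_indices m. q \<bottom> p i}"
  have nd: "nondegenerate_subspace ?Q" by (rule Suc.IH) (use Suc.prems I in auto)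
  have in1: "p k \<in> ?Q" using Suc.prems(1)[OF kI(1)] Suc.prems(2)[OF kI(1)] k by (auto simp: I)
  have in2: "p (- k) \<in> ?Q" using Suc.prems(1)[OF kI(2)] Suc.prems(2)[OF kI(2)] k by (auto simp: I)
  have "\<not> p k \<bottom> p (- k)" using Suc.prems(2)[OF kI] by simp
  from nondegenerate_subspace_perp[OF nd in1 in2 this]
  have "nondegenerate_subspace (?Q \<inter> perp (p k) \<inter> perp (p (- k)))" .
  moreover have "?Q \<inter> perp (p k) \<inter> perp (p (- k)) = {q \<in> P. \<forall>i\<in>signed_indices (Suc m). q \<bottom> p i}"
    unfolding I perp_def using collinear_sym by blast
  ultimately show ?case by simp
qed

text \<open>The only partner of \<open>p i\<close> is \<open>p (- i)\<close>; this also shows that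
  \<open>p\<close> is injective, which gives the size \<open>2 * n\<close>.\<close>

lemma frame_signed_indices:
  assumes P: "\<And>i. i \<in> signed_indices n \<Longrightarrow> p i \<in> P"
    and col: "\<And>i j. i \<in> signed_indices n \<Longrightarrow> j \<in> signed_indices n \<Longrightarrow> p i \<bottom> p j \<longleftrightarrow> j \<noteq> - i"
  shows "frame P L n (p ` signed_indices n)"
proof -
  have "inj_on p (signed_indices n)"
  proof (rule inj_onI)
    fix i j assume ij: "i \<in> signed_indices n" "j \<in> signed_indices n" "p i = p j"
    have "\<not> p i \<bottom> p (- i)" using col[OF ij(1) uminus_signed_indices[OF ij(1)]] by simp
    then have "\<not> p j \<bottom> p (- i)" using ij by simp
    then show "i = j" using col[OF ij(2) uminus_signed_indices[OF ij(1)]] by simp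
  qed
  then have "card (p ` signed_indices n) = 2 * n" by (simp add: card_image card_signed_indices)
  moreover have "\<exists>!q. q \<in> p ` signed_indices n \<and> \<not> p i \<bottom> q" if i: "i \<in> signed_indices n" for i
    by (rule ex1I[of _ "p (- i)"]) (use col[OF i] uminus_signed_indices[OF i] in auto)
  ultimately show ?thesis unfolding frame_def using P finite_signed_indices by auto
qed

lemma embedding_parabolic_apartment:
  assumes mn: "m \<le> n" and iso: "isometric_embedding (hypercube_vertices m) (hypercube_edges m)
                 (polar_grassmannian P L (int n - 1)) E f"
  shows "\<exists>M \<in> polar_grassmannian P L (int n - int m - 1).
           is_parabolic_apartment P L n M (f ` hypercube_vertices m)"
proof -
  obtain M p where M: "singular P L M" "rk M + m = n" "M \<subseteq> P"
    and pP: "\<And>i. i \<in> signed_indices m \<Longrightarrow> p i \<in> P"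
    and pp: "\<And>i j. i \<in> signed_indices m \<Longrightarrow> j \<in> signed_indices m \<Longrightarrow> p i \<bottom> p j \<longleftrightarrow> j \<noteq> - i"
    and fY: "\<And>Y. Y \<in> hypercube_vertices m \<Longrightarrow> f Y = span (M \<union> p ` Y)"
    and pM: "\<And>i x. i \<in> signed_indices m \<Longrightarrow> x \<in> M \<Longrightarrow> x \<bottom> p i"
    using embedding_structure[OF iso] by metis
  obtain X where X: "basis X M" using basis_exists[OF M(1)] by blast
  have X': "finite X" "independent P L X" "span X = M" "X \<subseteq> M"
    using X span_superset[of X] by (auto simp: basis_def)
  have clX: "clique X" by (rule basis_clique[OF M(1) X])
  let ?Q = "{q \<in> P. \<forall>i\<in>signed_indices m. q \<bottom> p i}"
  have nd: "nondegenerate_subspace ?Q" by (rule nondegenerate_subspace_perp_frame[OF pP pp])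
  have XQ: "X \<subseteq> ?Q" using X'(4) M(3) pM by blast
  obtain g where g: "\<And>x. x \<in> X \<Longrightarrow> g x \<in> ?Q"
    "\<And>x y. x \<in> X \<Longrightarrow> y \<in> X \<Longrightarrow> g x \<bottom> g y \<and> (x \<bottom> g y \<longleftrightarrow> x \<noteq> y)"
    using opposite_basis_exists[OF X'(1) nd clX X'(2) XQ] by blast
  \<comment> \<open>The indices up to \<open>m\<close> in absolute value belong to the points
    \<open>p i\<close>. The \<open>n - m\<close> elements of \<open>W\<close> enumerate the basis
    \<open>X\<close> of \<open>M\<close>, and their negatives the opposite points.\<close>
  define W where "W = {int m + 1..int n}"
  have "card W = card X" using rk_basis[OF M(1) X] M(2) by (simp add: W_def)
  then obtain h where h: "bij_betw h W X"
    using finite_same_card_bij[of W X] X'(1) by (auto simp: W_def)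
  have hX: "h i \<in> X" if "i \<in> W" for i using h that by (auto simp: bij_betw_def)
  define q where "q i = (if \<bar>i\<bar> \<le> int m then p i else if i > 0 then h i else g (h (- i)))" for i
  have q_small: "q i = p i" if "i \<in> signed_indices m" for i using that by (simp add: q_def signed_indices_def)
  have q_pos: "q i = h i" if "i \<in> W" for i using that by (simp add: q_def W_def)
  have q_neg: "q i = g (h (- i))" if "- i \<in> W" for i using that by (simp add: q_def W_def)
  have split: "i \<in> signed_indices m \<or> i \<in> W \<or> - i \<in> W" if "i \<in> signed_indices n" for i
    using that by (auto simp: signed_indices_def W_def)
  have excl: "i \<notin> signed_indices m" "- i \<notin> signed_indices m" "- i \<notin> W" if "i \<in> W" for i
    using that by (auto simp: signed_indices_def W_def)
  have sub: "signed_indices m \<subseteq> signed_indices n" "W \<subseteq> signed_indices n"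
    using mn by (auto simp: signed_indices_def W_def)
  have qQ: "q i \<in> ?Q" if "i \<in> W \<or> - i \<in> W" for i
    using that q_pos q_neg hX XQ g(1) by (metis (no_types, lifting) subsetD)
  have qP: "q i \<in> P" if "i \<in> signed_indices n" for i
    using split[OF that] q_small pP qQ by auto
  have qq: "q i \<bottom> q j \<longleftrightarrow> j \<noteq> - i" if ij: "i \<in> signed_indices n" "j \<in> signed_indices n" for i j
  proof -
    have small: "q i \<bottom> q j \<longleftrightarrow> j \<noteq> - i"
      if "i \<in> signed_indices m" "j \<in> W \<or> - j \<in> W" for i j
    proof -
      have "q j \<bottom> q i" using qQ[OF that(2)] that(1) q_small by simp
      moreover have "j \<noteq> - i" using that excl uminus_signed_indices by (metis add.inverse_inverse)
      ultimately show ?thesis using collinear_sym by blast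
    qed
    have posneg: "q i \<bottom> q j \<longleftrightarrow> j \<noteq> - i" if "i \<in> W" "- j \<in> W" for i j
    proof -
      have "q i \<bottom> q j \<longleftrightarrow> h i \<noteq> h (- j)"
        using g(2)[OF hX[OF that(1)] hX[OF that(2)]] q_pos[OF that(1)] q_neg[OF that(2)] by simp
      also have "\<dots> \<longleftrightarrow> i \<noteq> - j" using h that by (auto simp: bij_betw_def inj_on_def)
      finally show ?thesis by auto
    qed
    consider "i \<in> signed_indices m" "j \<in> signed_indices m" | "i \<in> signed_indices m" "j \<in> W \<or> - j \<in> W"
      | "j \<in> signed_indices m" "i \<in> W \<or> - i \<in> W" | "i \<in> W" "j \<in> W" | "- i \<in> W" "- j \<in> W"
      | "i \<in> W" "- j \<in> W" | "- i \<in> W" "j \<in> W"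
      using split[OF ij(1)] split[OF ij(2)] by blast
    then show ?thesis
    proof cases
      case 1 then show ?thesis using pp q_small by simp
    next
      case 2 then show ?thesis by (rule small)
    next
      case 3 then show ?thesis using small[OF 3] collinear_commute[of "q i" "q j"] by auto
    next
      case 4
      then have "j \<noteq> - i" using excl(3) by blast
      then show ?thesis using 4 hX q_pos clX by (auto simp: clique_def)
    next
      case 5
      then have "j \<noteq> - i" using excl(3)[of "- i"] by auto
      then show ?thesis using 5 hX q_neg g(2) by auto
    next
      case 6 then show ?thesis by (rule posneg)
    next
      case 7 then show ?thesis using posneg[OF 7(2,1)] collinear_commute[of "q i" "q j"] by auto
    qed
  qed
  let ?B = "q ` signed_indices n"
  have fr: "frame P L n ?B" by (rule frame_signed_indices[OF qP qq])
  have qW: "q ` W = X" using q_pos h by (auto simp: bij_betw_def)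
  have qWB: "q ` W \<subseteq> ?B" using sub by blast
  have XP: "X \<subseteq> P" using X'(4) M(3) by blast
  have fq: "f Y = span (q ` (Y \<union> W))" if Y: "Y \<in> hypercube_vertices m" for Y
  proof -
    have YI: "Y \<subseteq> signed_indices m" by (rule hypercube_vertex_subset[OF Y])
    then have "p ` Y = q ` Y" "p ` Y \<subseteq> P" using q_small pP by force+
    then have "f Y = span (span X \<union> q ` Y)" using fY[OF Y] X'(3) by simp
    also have "\<dots> = span (X \<union> q ` Y)"
      by (rule span_Un_span[OF XP]) (use \<open>p ` Y = q ` Y\<close> \<open>p ` Y \<subseteq> P\<close> in simp)
    also have "X \<union> q ` Y = q ` (Y \<union> W)" using qW by (auto simp: image_Un)
    finally show ?thesis .
  qed
  have "f ` hypercube_vertices m = apartment P L ?B \<inter> containing P L M (int n - 1)"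
  proof (intro equalityI subsetI)
    fix S assume "S \<in> f ` hypercube_vertices m"
    then obtain Y where Y: "Y \<in> hypercube_vertices m" "S = f Y" by blast
    have mS: "maximal_singular P L S" using embedding_maximal[OF iso Y(1)] Y(2) by simp
    have "Y \<union> W \<subseteq> signed_indices n" using hypercube_vertex_subset[OF Y(1)] sub by blast
    then have "S \<in> apartment P L ?B" unfolding apartment_def using mS fq[OF Y(1)] Y(2) by blast
    moreover have "M \<subseteq> S" using fY[OF Y(1)] Y(2) span_superset[of "M \<union> p ` Y"] by simp
    ultimately show "S \<in> apartment P L ?B \<inter> containing P L M (int n - 1)"
      using mS polar_grassmannian_top_iff by (simp add: containing_def)
  next
    fix S assume "S \<in> apartment P L ?B \<inter> containing P L M (int n - 1)"
    then obtain Z where S: "maximal_singular P L S" "M \<subseteq> S" and Z: "Z \<subseteq> ?B" "S = span Z"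
      by (auto simp: apartment_def containing_def)
    note sS = maximal_singular_singular[OF S(1)]
    have ZP: "Z \<subseteq> P" using Z(1) qP by blast
    have not_both: "\<not> (q i \<in> S \<and> q (- i) \<in> S)" if i: "i \<in> signed_indices n" for i
      using singular_collinear[OF sS] qq[OF i uminus_signed_indices[OF i]] by blast
    \<comment> \<open>If \<open>q (- i)\<close> is not in \<open>S\<close>, then \<open>q i\<close>
      is collinear with every generator in \<open>Z\<close>, and maximality puts \<open>q i\<close>
      into \<open>S\<close>.\<close>
    have in_S: "q i \<in> S" if i: "i \<in> signed_indices n" "q (- i) \<notin> S" for i
    proof -
      have "q i \<bottom> z" if z: "z \<in> Z" for z
      proof -
        obtain j where j: "j \<in> signed_indices n" "z = q j" using z Z(1) by blast
        have "z \<in> S" using z Z(2) span_superset[of Z] by blast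
        then have "j \<noteq> - i" using j i by blast
        then show ?thesis using qq[OF i(1) j(1)] j(2) by simp
      qed
      then have "q i \<bottom> s" if "s \<in> S" for s using collinear_span[OF qP[OF i(1)] ZP] that Z(2) by blast
      then show ?thesis by (rule maximal_singular_perp[OF S(1) qP[OF i(1)]])
    qed
    \<comment> \<open>The signs of \<open>S\<close> on the first \<open>m\<close> pairs; on the
      other pairs they are fixed by \<open>M \<subseteq> S\<close>.\<close>
    define Y where "Y = {i \<in> signed_indices m. q i \<in> S}"
    have Y: "Y \<in> hypercube_vertices m" unfolding hypercube_vertices_iff Y_def
      using not_both in_S sub(1) uminus_signed_indices by blast
    have "Z \<subseteq> q ` (Y \<union> W)"
    proof
      fix z assume z: "z \<in> Z"
      obtain j where j: "j \<in> signed_indices n" "z = q j" using z Z(1) by blast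
      have zS: "q j \<in> S" using z j(2) Z(2) span_superset[of Z] by blast
      have "- j \<notin> W"
      proof
        assume "- j \<in> W"
        then have "q (- j) \<in> S" using qW X'(4) S(2) by blast
        then show False using not_both[OF j(1)] zS by blast
      qed
      then have "j \<in> Y \<union> W" using split[OF j(1)] zS by (auto simp: Y_def)
      then show "z \<in> q ` (Y \<union> W)" using j(2) by blast
    qed
    then have "S \<subseteq> f Y" using Z(2) fq[OF Y] span_mono by blast
    then have "f Y = S"
      using S(1) maximal_singular_singular[OF embedding_maximal[OF iso Y]] by (simp add: maximal_singular_def)
    then show "S \<in> f ` hypercube_vertices m" using Y by blast
  qed
  then have "is_parabolic_apartment P L n M (f ` hypercube_vertices m)"
    unfolding is_parabolic_apartment_def using fr qWB qW X'(3) by blast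
  moreover have "M \<in> polar_grassmannian P L (int n - int m - 1)"
    using M mn by (simp add: polar_grassmannian_iff)
  ultimately show ?thesis by blast
qed

end

theorem theorem2:
  fixes P :: "'a set" and L :: "'a set set" and n m :: nat
  assumes "polar_space P L" and "has_rank P L n" and "m \<le> n"
  shows "(\<forall>f. isometric_embedding (hypercube_vertices m) (hypercube_edges m)
                 (polar_grassmannian P L (int n - 1)) (dual_polar_edges P L n) f \<longrightarrow>
              (\<exists>M \<in> polar_grassmannian P L (int n - int m - 1).
                 is_parabolic_apartment P L n M (f ` hypercube_vertices m))) \<and>
         (\<forall>f. isometric_embedding (hypercube_vertices n) (hypercube_edges n)
                 (polar_grassmannian P L (int n - 1)) (dual_polar_edges P L n) f \<longrightarrow>
              is_apartment P L n (f ` hypercube_vertices n))"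
proof -
  interpret polar_space P L by (rule assms(1))
  interpret ranked_polar_space P L n by unfold_locales (rule assms(2))
  show ?thesis
  proof (intro conjI allI impI)
    fix f :: "int set \<Rightarrow> 'a set"
    assume "isometric_embedding (hypercube_vertices m) (hypercube_edges m)
                 (polar_grassmannian P L (int n - 1)) (dual_polar_edges P L n) f"
    then show "\<exists>M \<in> polar_grassmannian P L (int n - int m - 1).
                 is_parabolic_apartment P L n M (f ` hypercube_vertices m)"
      by (rule embedding_parabolic_apartment[OF assms(3)])
  next
    fix f :: "int set \<Rightarrow> 'a set"
    assume "isometric_embedding (hypercube_vertices n) (hypercube_edges n)
                 (polar_grassmannian P L (int n - 1)) (dual_polar_edges P L n) f"
    then obtain M where M: "M \<in> polar_grassmannian P L (int n - int n - 1)"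
      and ap: "is_parabolic_apartment P L n M (f ` hypercube_vertices n)"
      using embedding_parabolic_apartment[OF order_refl] by blast
    \<comment> \<open>Dimension \<open>-1\<close> is rank \<open>0\<close>, so \<open>M\<close> is
      empty and containing it is no restriction.\<close>
    have sM: "singular P L M" "rk M = 0" using M by (auto simp: polar_grassmannian_iff)
    obtain X where X: "basis X M" using basis_exists[OF sM(1)] by blast
    have "card X = 0" using rk_basis[OF sM(1) X] sM(2) by simp
    then have "M = {}" using X span_empty by (auto simp: basis_def)
    then have "apartment P L B \<inter> containing P L M (int n - 1) = apartment P L B" for B
      by (auto simp: containing_def polar_grassmannian_top_iff apartment_def)
    then show "is_apartment P L n (f ` hypercube_vertices n)"
      using ap unfolding is_apartment_def is_parabolic_apartment_def by auto
  qed
qed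

end
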